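(* For every completely regular frame $L$, the set $\mathrm{Coz}_c[L]=\{\mathrm{coz}(\alpha)\mid \alpha\in\mathcal C_c(L)\}$ (with the order inherited from $L$) is a $\sigma$-frame.
   Context: Let $L$ be a frame with top $\top$ and bottom $\bot$. The frame of reals $\mathcal L(\mathbb R)$ is generated by pairs $(p,q)$, $p,q\in\mathbb Q$, subject to: (R1) $(p,q)\wedge(r,s)=(p\vee r,q\wedge s)$; (R2) $(p,q)\vee(r,s)=(p,s)$ whenever $p\le r<q\le s$; (R3) $(p,q)=\bigvee\{(r,s)\mid p<r<s<q\}$; (R4) $\top=\bigvee\{(p,q)\mid p,q\in\mathbb Q\}$. $\mathcal R(L)$ is the set of frame homomorphisms $\mathcal L(\mathbb R)\to L$; it is an $f$-ring with operations, for $\diamond\in\{+,\cdot,\wedge,\vee\}$, $(\alpha\diamond\beta)(p,q)=\bigvee\{\alpha(r,s)\wedge\beta(u,v)\mid \langle r,s\rangle\diamond\langle u,v\rangle\subseteq\langle p,q\rangle\}$, where $\langle p,q\rangle=\{t\in\mathbb R\mid p<t<q\}$. For $r\in\mathbb R$, the constant $\mathbf r\in\mathcal R(L)$ satisfies $\mathbf r(p,q)=\top$ if $p<r<q$ and $\bot$ otherwise; $\alpha-r$ means $\alpha-\mathbf r$. Put $(p,-)=\bigvee_{r,s>p}(r,s)$ and $(-,q)=\bigvee_{r,s<q}(r,s)$ (with $r,s\in\mathbb Q$). The cozero element of $\alpha$ is $\mathrm{coz}(\alpha)=\alpha(-,0)\vee\alpha(0,-)$. Put $R_\alpha=\{r\in\mathbb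 R\mid \mathrm{coz}(\alpha-r)\ne\top\}$ and $\mathcal C_c(L)=\{\alpha\in\mathcal R(L)\mid R_\alpha\text{ is countable}\}$ (countable includes finite). $L$ is completely regular iff every element of $L$ is the join of elements of the form $\mathrm{coz}(\alpha)$, $\alpha\in\mathcal R(L)$. A $\sigma$-frame is a distributive lattice $M$ in which every countable subset has a join and $a\wedge\bigvee S=\bigvee_{s\in S}(a\wedge s)$ for all $a\in M$ and countable $S\subseteq M$. *)

theory Defs
  imports
    Complex_Main
    "HOL-Library.Countable_Set"
    "HOL-Algebra.Lattice"
begin

(* HOL-Algebra's lattice operations take the structure as an argument and would otherwise shadow
   the type-class operations inf, sup and top. *)
hide_const (open) Lattice.inf Lattice.sup Order.top

section \<open>Frames\<close>

class frame = complete_lattice +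
  assumes inf_Sup_frame: "inf a (Sup S) = Sup ((\<lambda>s. inf a s) ` S)"

definition frame_hom :: "('a::frame \<Rightarrow> 'b::frame) \<Rightarrow> bool" where
  "frame_hom h \<longleftrightarrow>
     h top = top \<and> (\<forall>x y. h (inf x y) = inf (h x) (h y)) \<and> (\<forall>S. h (Sup S) = Sup (h ` S))"

lemma frame_homI:
  assumes "h top = top" "\<And>x y. h (inf x y) = inf (h x) (h y)" "\<And>S. h (Sup S) = Sup (h ` S)"
  shows "frame_hom h"
  using assms by (simp add: frame_hom_def)

lemma frame_hom_mono:
  assumes "frame_hom h" "x \<le> y"
  shows "h x \<le> h y"
  using assms unfolding frame_hom_def by (metis inf.absorb_iff1)

lemma Sup_inf_frame: "inf (Sup S) a = Sup ((\<lambda>s. inf s a) ` S)" for a :: "'a::frame"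
  using inf_Sup_frame[of a S] by (simp add: inf.commute)

section \<open>Free frames\<close>

text \<open>The finite subsets of the set of generators, ordered by reverse inclusion, form the free
  meet-semilattice (a finite set stands for the meet of its elements). The free frame consists of
  its down-sets.\<close>

typedef 'g free_frame =
  "{U :: 'g set set. (\<forall>A\<in>U. finite A) \<and> (\<forall>A B. A \<in> U \<longrightarrow> A \<subseteq> B \<longrightarrow> finite B \<longrightarrow> B \<in> U)}"
  by (rule exI[of _ "{}"]) simp

setup_lifting type_definition_free_frame

instantiation free_frame :: (type) frame
begin

lift_definition less_eq_free_frame :: "'a free_frame \<Rightarrow> 'a free_frame \<Rightarrow> bool" is "(\<subseteq>)" .
lift_definition less_free_frame :: "'a free_frame \<Rightarrow> 'a free_frame \<Rightarrow> bool" is "(\<subset>)" .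
lift_definition inf_free_frame :: "'a free_frame \<Rightarrow> 'a free_frame \<Rightarrow> 'a free_frame" is "(\<inter>)"
  by blast
lift_definition sup_free_frame :: "'a free_frame \<Rightarrow> 'a free_frame \<Rightarrow> 'a free_frame" is "(\<union>)"
  by blast
lift_definition top_free_frame :: "'a free_frame" is "{A. finite A}"
  by blast
lift_definition bot_free_frame :: "'a free_frame" is "{}"
  by blast
lift_definition Sup_free_frame :: "'a free_frame set \<Rightarrow> 'a free_frame" is "Union"
  by blast
lift_definition Inf_free_frame :: "'a free_frame set \<Rightarrow> 'a free_frame"
  is "\<lambda>\<U>. {A. finite A \<and> (\<forall>U\<in>\<U>. A \<in> U)}"
  by blast

instance
proof
  fix a :: "'a free_frame" and S
  show "inf a (Sup S) = Sup (inf a ` S)"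
    by transfer blast
next
  fix x z :: "'a free_frame" and A
  show "x \<in> A \<Longrightarrow> Inf A \<le> x"
    by (auto simp: less_eq_free_frame.rep_eq Inf_free_frame.rep_eq)
  show "(\<And>x. x \<in> A \<Longrightarrow> z \<le> x) \<Longrightarrow> z \<le> Inf A"
    using Rep_free_frame[of z]
    by (simp add: less_eq_free_frame.rep_eq Inf_free_frame.rep_eq) blast
  show "x \<in> A \<Longrightarrow> x \<le> Sup A"
    by (auto simp: less_eq_free_frame.rep_eq Sup_free_frame.rep_eq)
  show "(\<And>x. x \<in> A \<Longrightarrow> x \<le> z) \<Longrightarrow> Sup A \<le> z"
    by (simp add: less_eq_free_frame.rep_eq Sup_free_frame.rep_eq) blast
  show "Inf {} = (top :: 'a free_frame)"
    by transfer simp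
  show "Sup {} = (bot :: 'a free_frame)"
    by transfer simp
qed (auto simp: less_eq_free_frame.rep_eq less_free_frame.rep_eq inf_free_frame.rep_eq
      sup_free_frame.rep_eq Rep_free_frame_inject[symmetric])

end

lift_definition free_gen :: "'g \<Rightarrow> 'g free_frame" is "\<lambda>g. {A. finite A \<and> g \<in> A}"
  by auto

definition free_lift :: "('g \<Rightarrow> 'a::frame) \<Rightarrow> 'g free_frame \<Rightarrow> 'a" where
  "free_lift f x = (SUP A\<in>Rep_free_frame x. INF g\<in>A. f g)"

lemma free_lift_gen: "free_lift f (free_gen g) = f g"
proof -
  have "(SUP A\<in>{A. finite A \<and> g \<in> A}. INF g\<in>A. f g) = f g"
  proof (rule antisym)
    show "(SUP A\<in>{A. finite A \<and> g \<in> A}. INF g\<in>A. f g) \<le> f g"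
      by (auto intro!: SUP_least INF_lower)
    have "f g = (INF g\<in>{g}. f g)" by simp
    also have "\<dots> \<le> (SUP A\<in>{A. finite A \<and> g \<in> A}. INF g\<in>A. f g)"
      by (rule SUP_upper) simp
    finally show "f g \<le> (SUP A\<in>{A. finite A \<and> g \<in> A}. INF g\<in>A. f g)" .
  qed
  then show ?thesis by (simp add: free_lift_def free_gen.rep_eq)
qed

lemma frame_hom_free_lift: "frame_hom (free_lift f)"
proof (rule frame_homI)
  show "free_lift f top = top"
  proof (rule top_le)
    have "top = (INF g\<in>{}. f g)" by simp
    also have "\<dots> \<le> free_lift f top"
      unfolding free_lift_def by (rule SUP_upper) (simp add: top_free_frame.rep_eq)
    finally show "top \<le> free_lift f top" .
  qed
next
  fix x y :: "'a free_frame"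
  show "free_lift f (inf x y) = inf (free_lift f x) (free_lift f y)"
  proof (rule antisym)
    show "free_lift f (inf x y) \<le> inf (free_lift f x) (free_lift f y)"
      unfolding free_lift_def by (auto simp: inf_free_frame.rep_eq intro!: SUP_subset_mono)
    have "inf (INF g\<in>A. f g) (INF g\<in>B. f g) \<le> free_lift f (inf x y)"
      if "A \<in> Rep_free_frame x" "B \<in> Rep_free_frame y" for A B
    proof -
      have "A \<union> B \<in> Rep_free_frame (inf x y)"
        using that Rep_free_frame[of x] Rep_free_frame[of y]
        by (simp add: inf_free_frame.rep_eq)
      then have "(INF g\<in>A \<union> B. f g) \<le> free_lift f (inf x y)"
        unfolding free_lift_def by (rule SUP_upper)
      then show ?thesis by (simp add: INF_union)
    qed
    then show "inf (free_lift f x) (free_lift f y) \<le> free_lift f (inf x y)"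
      by (auto simp: free_lift_def[of f x] free_lift_def[of f y] Sup_inf_frame inf_Sup_frame
            image_image intro!: SUP_least)
  qed
next
  fix S :: "'a free_frame set"
  show "free_lift f (Sup S) = Sup (free_lift f ` S)"
    by (simp add: free_lift_def Sup_free_frame.rep_eq SUP_UNION image_image)
qed

lemma free_frame_join_of_meets:
  "x = (SUP A\<in>Rep_free_frame x. INF g\<in>A. free_gen g)"
proof -
  have eq: "Rep_free_frame (INF g\<in>A. free_gen g) = {B. finite B \<and> A \<subseteq> B}" for A :: "'a set"
    by (auto simp: Inf_free_frame.rep_eq free_gen.rep_eq)
  have "Rep_free_frame x = (\<Union>A\<in>Rep_free_frame x. {B. finite B \<and> A \<subseteq> B})"
    using Rep_free_frame[of x] by blast
  also have "\<dots> = Rep_free_frame (SUP A\<in>Rep_free_frame x. INF g\<in>A. free_gen g)"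
    by (simp only: Sup_free_frame.rep_eq image_image eq)
  finally show ?thesis by (simp add: Rep_free_frame_inject)
qed

lemma frame_hom_finite_INF:
  assumes "frame_hom h" "finite A"
  shows "h (INF g\<in>A. k g) = (INF g\<in>A. h (k g))"
  using assms(2,1) by (induction A) (auto simp: frame_hom_def)

lemma free_hom_unique:
  assumes h: "frame_hom h" and h': "frame_hom h'" and "\<And>g. h (free_gen g) = h' (free_gen g)"
  shows "h = h'"
proof
  fix x :: "'a free_frame"
  have fin: "finite A" if "A \<in> Rep_free_frame x" for A
    using Rep_free_frame[of x] that by blast
  have "h x = h (SUP A\<in>Rep_free_frame x. INF g\<in>A. free_gen g)"
    using free_frame_join_of_meets[of x] by simp
  also have "\<dots> = (SUP A\<in>Rep_free_frame x. INF g\<in>A. h (free_gen g))"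
    using h by (simp add: frame_hom_def image_image frame_hom_finite_INF[OF h fin])
  also have "\<dots> = (SUP A\<in>Rep_free_frame x. INF g\<in>A. h' (free_gen g))"
    using assms by simp
  also have "\<dots> = h' (SUP A\<in>Rep_free_frame x. INF g\<in>A. free_gen g)"
    using h' by (simp add: frame_hom_def image_image frame_hom_finite_INF[OF h' fin])
  also have "\<dots> = h' x"
    using free_frame_join_of_meets[of x] by simp
  finally show "h x = h' x" .
qed

section \<open>The frame of reals\<close>

text \<open>Pairs (left-hand side, right-hand side) of the defining relations, for an assignment \<open>G\<close> of
  elements of a frame to the generators. Note that \<open>G p q\<close> is not required to have \<open>p < q\<close>.\<close>

inductive_set real_relations :: "(rat \<Rightarrow> rat \<Rightarrow> 'a::frame) \<Rightarrow> ('a \<times> 'a) set"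
  for G :: "rat \<Rightarrow> rat \<Rightarrow> 'a" where
  R1: "(inf (G p q) (G r s), G (max p r) (min q s)) \<in> real_relations G"
| R2: "p \<le> r \<Longrightarrow> r < q \<Longrightarrow> q \<le> s \<Longrightarrow> (sup (G p q) (G r s), G p s) \<in> real_relations G"
| R3: "(G p q, Sup {G r s | r s. p < r \<and> r < s \<and> s < q}) \<in> real_relations G"
| R4: "(top, Sup {G p q | p q. True}) \<in> real_relations G"

definition free_interval :: "rat \<Rightarrow> rat \<Rightarrow> (rat \<times> rat) free_frame" where
  "free_interval p q = free_gen (p, q)"

text \<open>The quotient of a frame \<open>F\<close> by a set \<open>R\<close> of pairs is realised, as usual, by the elements \<open>x\<close>
  of \<open>F\<close> that are saturated: \<open>a \<sqinter> c \<le> x\<close> iff \<open>b \<sqinter> c \<le> x\<close>, for all \<open>(a, b) \<in> R\<close> and \<open>c \<in> F\<close>. The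
  presentation is justified by \<open>interval_relations\<close> and \<open>ex1_frame_hom_extension\<close> below.\<close>

definition saturated :: "('a::frame \<times> 'a) set \<Rightarrow> 'a \<Rightarrow> bool" where
  "saturated R x \<longleftrightarrow> (\<forall>(a, b)\<in>R. \<forall>c. inf a c \<le> x \<longleftrightarrow> inf b c \<le> x)"

lemma saturated_Inf: "(\<And>x. x \<in> S \<Longrightarrow> saturated R x) \<Longrightarrow> saturated R (Inf S)"
  unfolding saturated_def by (fastforce simp: le_Inf_iff)

lemma saturated_inf: "saturated R x \<Longrightarrow> saturated R y \<Longrightarrow> saturated R (inf x y)"
  using saturated_Inf[of "{x, y}" R] by auto

lemma saturated_top: "saturated R top"
  using saturated_Inf[of "{}" R] by simp

typedef frame_of_reals = "{x. saturated (real_relations free_interval) x}"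
  using saturated_top by blast

setup_lifting type_definition_frame_of_reals

definition saturation :: "('a::frame \<times> 'a) set \<Rightarrow> 'a \<Rightarrow> 'a" where
  "saturation R x = Inf {y. saturated R y \<and> x \<le> y}"

lemma saturated_saturation: "saturated R (saturation R x)"
  unfolding saturation_def by (rule saturated_Inf) simp

lemma saturation_ge: "x \<le> saturation R x"
  unfolding saturation_def by (rule Inf_greatest) simp

lemma saturation_le_iff: "saturated R y \<Longrightarrow> saturation R x \<le> y \<longleftrightarrow> x \<le> y"
  using saturation_ge[of x R] by (auto simp: saturation_def intro: Inf_lower order_trans)

lemma saturation_eq: "saturated R x \<Longrightarrow> saturation R x = x"
  by (simp add: antisym saturation_ge saturation_le_iff)

lemma saturated_impl:
  assumes "saturated R y"
  shows "saturated R (Sup {c. inf c a \<le> y})" and "d \<le> Sup {c. inf c a \<le> y} \<longleftrightarrow> inf d a \<le> y"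
proof -
  have *: "d \<le> Sup {c. inf c a \<le> y} \<longleftrightarrow> inf d a \<le> y" for d
  proof
    assume "d \<le> Sup {c. inf c a \<le> y}"
    then have "inf d a \<le> inf (Sup {c. inf c a \<le> y}) a" by (rule inf_mono) simp
    also have "\<dots> \<le> y" by (auto simp: Sup_inf_frame intro!: SUP_least)
    finally show "inf d a \<le> y" .
  qed (simp add: Sup_upper)
  then show "d \<le> Sup {c. inf c a \<le> y} \<longleftrightarrow> inf d a \<le> y" .
  show "saturated R (Sup {c. inf c a \<le> y})"
    using assms unfolding saturated_def * by (auto simp: inf_assoc)
qed

lemma inf_saturation_le:
  assumes "saturated R y"
  shows "inf (saturation R x) a \<le> y \<longleftrightarrow> inf x a \<le> y"
proof -
  have "inf (saturation R x) a \<le> y \<longleftrightarrow> saturation R x \<le> Sup {c. inf c a \<le> y}"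
    by (simp add: saturated_impl(2)[OF assms])
  also have "\<dots> \<longleftrightarrow> x \<le> Sup {c. inf c a \<le> y}"
    by (rule saturation_le_iff[OF saturated_impl(1)[OF assms]])
  also have "\<dots> \<longleftrightarrow> inf x a \<le> y"
    by (simp add: saturated_impl(2)[OF assms])
  finally show ?thesis .
qed

lemma saturation_inf: "saturation R (inf x y) = inf (saturation R x) (saturation R y)"
proof (rule antisym)
  show "saturation R (inf x y) \<le> inf (saturation R x) (saturation R y)"
    by (simp add: saturation_le_iff saturated_saturation le_infI1 le_infI2 saturation_ge)
  have sat: "saturated R (saturation R (inf x y))" by (rule saturated_saturation)
  have "inf y (saturation R x) \<le> saturation R (inf x y)"
    using inf_saturation_le[OF sat, of x y] saturation_ge[of "inf x y" R]
    by (simp add: inf.commute)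
  then show "inf (saturation R x) (saturation R y) \<le> saturation R (inf x y)"
    using inf_saturation_le[OF sat, of y "saturation R x"] by (simp add: inf.commute)
qed

instantiation frame_of_reals :: frame
begin

lift_definition less_eq_frame_of_reals :: "frame_of_reals \<Rightarrow> frame_of_reals \<Rightarrow> bool" is "(\<le>)" .
lift_definition less_frame_of_reals :: "frame_of_reals \<Rightarrow> frame_of_reals \<Rightarrow> bool" is "(<)" .
lift_definition inf_frame_of_reals :: "frame_of_reals \<Rightarrow> frame_of_reals \<Rightarrow> frame_of_reals" is inf
  by (rule saturated_inf)
lift_definition sup_frame_of_reals :: "frame_of_reals \<Rightarrow> frame_of_reals \<Rightarrow> frame_of_reals"
  is "\<lambda>x y. saturation (real_relations free_interval) (sup x y)"
  by (rule saturated_saturation)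
lift_definition top_frame_of_reals :: frame_of_reals is top
  by (rule saturated_top)
lift_definition bot_frame_of_reals :: frame_of_reals
  is "saturation (real_relations free_interval) bot"
  by (rule saturated_saturation)
lift_definition Inf_frame_of_reals :: "frame_of_reals set \<Rightarrow> frame_of_reals" is Inf
  by (rule saturated_Inf)
lift_definition Sup_frame_of_reals :: "frame_of_reals set \<Rightarrow> frame_of_reals"
  is "\<lambda>S. saturation (real_relations free_interval) (Sup S)"
  by (rule saturated_saturation)

instance
proof
  fix a :: frame_of_reals and S
  show "inf a (Sup S) = Sup (inf a ` S)"
  proof transfer
    fix a S
    let ?\<nu> = "saturation (real_relations free_interval)"
    assume "saturated (real_relations free_interval) a"
    then have "inf a (?\<nu> (Sup S)) = ?\<nu> (inf a (Sup S))"
      by (simp add: saturation_inf saturation_eq)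
    then show "inf a (?\<nu> (Sup S)) = ?\<nu> (Sup (inf a ` S))"
      by (simp add: inf_Sup_frame)
  qed
next
  fix x y z :: frame_of_reals
  show "x \<le> sup x y" "y \<le> sup x y"
    by (transfer; metis le_sup_iff saturation_ge)+
  show "y \<le> x \<Longrightarrow> z \<le> x \<Longrightarrow> sup y z \<le> x"
    by transfer (simp add: saturation_le_iff)
next
  fix x z :: frame_of_reals and A
  show "x \<in> A \<Longrightarrow> Inf A \<le> x"
    by transfer (rule Inf_lower)
  show "(\<And>x. x \<in> A \<Longrightarrow> z \<le> x) \<Longrightarrow> z \<le> Inf A"
    by transfer (simp add: Inf_greatest)
  show "x \<in> A \<Longrightarrow> x \<le> Sup A"
    by transfer (meson Sup_upper order_trans saturation_ge)
  show "(\<And>x. x \<in> A \<Longrightarrow> x \<le> z) \<Longrightarrow> Sup A \<le> z"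
    by transfer (simp add: saturation_le_iff Sup_least)
qed (auto simp: less_eq_frame_of_reals.rep_eq less_frame_of_reals.rep_eq
      inf_frame_of_reals.rep_eq top_frame_of_reals_def[symmetric]
      bot_frame_of_reals_def[symmetric] Inf_frame_of_reals_def Sup_frame_of_reals_def
      Rep_frame_of_reals_inject[symmetric] less_le_not_le)

end

lift_definition quot :: "(rat \<times> rat) free_frame \<Rightarrow> frame_of_reals"
  is "saturation (real_relations free_interval)"
  by (rule saturated_saturation)

definition interval :: "rat \<Rightarrow> rat \<Rightarrow> frame_of_reals" where
  "interval p q = quot (free_interval p q)"

lemma frame_hom_quot: "frame_hom quot"
proof (rule frame_homI)
  show "quot top = top"
    by transfer (simp add: saturation_eq saturated_top)
  show "quot (inf x y) = inf (quot x) (quot y)" for x y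
    by transfer (rule saturation_inf)
  show "quot (Sup S) = Sup (quot ` S)" for S
  proof transfer
    fix S :: "(rat \<times> rat) free_frame set"
    let ?\<nu> = "saturation (real_relations free_interval)"
    have sat: "saturated (real_relations free_interval) (?\<nu> x)" for x
      by (rule saturated_saturation)
    show "?\<nu> (Sup S) = ?\<nu> (Sup (?\<nu> ` S))"
    proof (rule antisym)
      have "Sup S \<le> Sup (?\<nu> ` S)"
        by (rule Sup_mono) (use saturation_ge in blast)
      also have "\<dots> \<le> ?\<nu> (Sup (?\<nu> ` S))" by (rule saturation_ge)
      finally show "?\<nu> (Sup S) \<le> ?\<nu> (Sup (?\<nu> ` S))"
        by (simp add: saturation_le_iff[OF sat])
      have "s \<le> ?\<nu> (Sup S)" if "s \<in> S" for s
        using Sup_upper[OF that] saturation_ge by (rule order_trans)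
      then have "Sup (?\<nu> ` S) \<le> ?\<nu> (Sup S)"
        by (auto simp: saturation_le_iff[OF sat] intro!: SUP_least)
      then show "?\<nu> (Sup (?\<nu> ` S)) \<le> ?\<nu> (Sup S)"
        by (simp add: saturation_le_iff[OF sat])
    qed
  qed
qed

lemma frame_hom_real_relations:
  assumes "frame_hom h"
  shows "real_relations (\<lambda>p q. h (G p q)) = map_prod h h ` real_relations G"
proof -
  have inf: "h (inf x y) = inf (h x) (h y)" and top: "h top = top"
    and Sup: "h (Sup S) = Sup (h ` S)" for x y S
    using assms by (auto simp: frame_hom_def)
  have sup: "h (sup x y) = sup (h x) (h y)" for x y
    using Sup[of "{x, y}"] by simp
  have im3: "h ` {G r s | r s. p < r \<and> r < s \<and> s < q} =
      {h (G r s) | r s. p < r \<and> r < s \<and> s < q}" for p q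
    by blast
  have im4: "h ` {G p q | p q. True} = {h (G p q) | p q. True}"
    by blast
  show ?thesis
  proof (intro equalityI subsetI)
    fix z assume "z \<in> real_relations (\<lambda>p q. h (G p q))"
    then obtain a b where z: "z = (a, b)" and "(a, b) \<in> real_relations (\<lambda>p q. h (G p q))"
      by (cases z) auto
    from this(2) show "z \<in> map_prod h h ` real_relations G"
    proof cases
      case (R1 p q r s)
      then show ?thesis
        by (intro image_eqI[OF _ real_relations.R1[of G p q r s]]) (simp add: z inf)
    next
      case (R2 p r q s)
      then show ?thesis
        by (intro image_eqI[OF _ real_relations.R2[of p r q s G]]) (simp_all add: z sup)
    next
      case (R3 p q)
      then have "z = map_prod h h (G p q, Sup {G r s | r s. p < r \<and> r < s \<and> s < q})"
        by (simp only: z map_prod_simp Sup im3)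
      then show ?thesis using real_relations.R3[of G p q] by blast
    next
      case R4
      then have "z = map_prod h h (top, Sup {G p q | p q. True})"
        by (simp only: z map_prod_simp Sup im4 top)
      then show ?thesis using real_relations.R4[of G] by blast
    qed
  next
    fix z assume "z \<in> map_prod h h ` real_relations G"
    then obtain a b where z: "z = (h a, h b)" and "(a, b) \<in> real_relations G" by auto
    from this(2) show "z \<in> real_relations (\<lambda>p q. h (G p q))"
    proof cases
      case (R1 p q r s)
      then show ?thesis
        using real_relations.R1[of "\<lambda>p q. h (G p q)" p q r s] by (simp add: z inf)
    next
      case (R2 p r q s)
      then show ?thesis
        using real_relations.R2[of p r q s "\<lambda>p q. h (G p q)"] by (simp add: z sup)
    next
      case (R3 p q)
      then show ?thesis
        using real_relations.R3[of "\<lambda>p q. h (G p q)" p q] by (simp only: z Sup im3)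
    next
      case R4
      then show ?thesis
        using real_relations.R4[of "\<lambda>p q. h (G p q)"] by (simp only: z Sup im4 top)
    qed
  qed
qed

definition satisfies_real_relations :: "(rat \<Rightarrow> rat \<Rightarrow> 'a::frame) \<Rightarrow> bool" where
  "satisfies_real_relations f \<longleftrightarrow> (\<forall>(a, b)\<in>real_relations f. a = b)"

lemma satisfies_real_relations_iff:
  "satisfies_real_relations f \<longleftrightarrow>
     (\<forall>p q r s. inf (f p q) (f r s) = f (max p r) (min q s)) \<and>
     (\<forall>p q r s. p \<le> r \<longrightarrow> r < q \<longrightarrow> q \<le> s \<longrightarrow> sup (f p q) (f r s) = f p s) \<and>
     (\<forall>p q. f p q = Sup {f r s | r s. p < r \<and> r < s \<and> s < q}) \<and>
     top = Sup {f p q | p q. True}"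
  (is "_ \<longleftrightarrow> ?rhs")
proof
  assume "satisfies_real_relations f"
  then have eq: "a = b" if "(a, b) \<in> real_relations f" for a b
    using that by (auto simp: satisfies_real_relations_def)
  show ?rhs
    by (intro conjI allI impI eq real_relations.intros)
next
  assume rhs: ?rhs
  have "a = b" if "(a, b) \<in> real_relations f" for a b
    using that by cases (use rhs in blast)+
  then show "satisfies_real_relations f"
    by (auto simp: satisfies_real_relations_def)
qed

lemma real_relations_inf:
    "satisfies_real_relations f \<Longrightarrow> inf (f p q) (f r s) = f (max p r) (min q s)"
  and real_relations_sup:
    "satisfies_real_relations f \<Longrightarrow> p \<le> r \<Longrightarrow> r < q \<Longrightarrow> q \<le> s \<Longrightarrow> sup (f p q) (f r s) = f p s"
  and real_relations_Sup:
    "satisfies_real_relations f \<Longrightarrow> f p q = Sup {f r s | r s. p < r \<and> r < s \<and> s < q}"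
  and real_relations_top: "satisfies_real_relations f \<Longrightarrow> Sup {f p q | p q. True} = top"
  unfolding satisfies_real_relations_iff by metis+

lemma interval_relations: "satisfies_real_relations interval"
proof -
  have "quot a = quot b" if ab: "(a, b) \<in> real_relations free_interval" for a b
  proof -
    let ?R = "real_relations free_interval"
    have *: "a \<le> y \<longleftrightarrow> b \<le> y" if "saturated ?R y" for y
      using that ab unfolding saturated_def by (auto dest!: bspec[OF _ ab] spec[of _ top])
    have "saturation ?R a = saturation ?R b"
      unfolding saturation_def using * by (metis (no_types, lifting))
    then show ?thesis by transfer
  qed
  moreover have "interval = (\<lambda>p q. quot (free_interval p q))"
    by (simp add: fun_eq_iff interval_def)
  then have "real_relations interval = map_prod quot quot ` real_relations free_interval"
    using frame_hom_real_relations[OF frame_hom_quot, of free_interval] by metis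
  ultimately show ?thesis
    by (auto simp: satisfies_real_relations_def)
qed

lemma frame_hom_satisfies_real_relations:
  assumes "frame_hom h"
  shows "satisfies_real_relations (\<lambda>p q. h (interval p q))"
  using interval_relations
  by (auto simp: satisfies_real_relations_def frame_hom_real_relations[OF assms])

lemma frame_hom_interval_unique:
  assumes h: "frame_hom h" and h': "frame_hom h'"
    and eq: "\<And>p q. h (interval p q) = h' (interval p q)"
  shows "h = h'"
proof -
  have comp: "frame_hom (\<lambda>x. k (quot x))" if "frame_hom k" for k :: "frame_of_reals \<Rightarrow> 'a"
    using that frame_hom_quot by (simp add: frame_hom_def image_image)
  have "(\<lambda>x. h (quot x)) = (\<lambda>x. h' (quot x))"
    by (rule free_hom_unique[OF comp[OF h] comp[OF h']])
       (use eq in \<open>auto simp: interval_def free_interval_def\<close>)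
  moreover have "\<exists>y. x = quot y" for x
    by transfer (metis saturation_eq)
  ultimately show ?thesis by (metis ext)
qed

theorem ex1_frame_hom_extension:
  fixes f :: "rat \<Rightarrow> rat \<Rightarrow> 'a::frame"
  assumes f: "satisfies_real_relations f"
  shows "\<exists>!h. frame_hom h \<and> (\<forall>p q. h (interval p q) = f p q)"
proof -
  let ?R = "real_relations free_interval"
  define F where "F = free_lift (case_prod f)"
  have F: "frame_hom F" unfolding F_def by (rule frame_hom_free_lift)
  have Fgen: "F (free_interval p q) = f p q" for p q
    by (simp add: F_def free_interval_def free_lift_gen)
  have F_rel: "F a = F b" if "(a, b) \<in> ?R" for a b
  proof -
    have "(F a, F b) \<in> real_relations (\<lambda>p q. F (free_interval p q))"
      unfolding frame_hom_real_relations[OF F] using that by force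
    then show ?thesis using f by (auto simp: Fgen satisfies_real_relations_def)
  qed
  have F_sat: "F (saturation ?R x) = F x" for x
  proof (rule antisym)
    show "F x \<le> F (saturation ?R x)" by (rule frame_hom_mono[OF F saturation_ge])
    define y where "y = Sup {z. F z \<le> F x}"
    have Fy: "F y \<le> F x"
      using F by (auto simp: y_def frame_hom_def intro!: SUP_least)
    have y: "z \<le> y \<longleftrightarrow> F z \<le> F x" for z
      using Fy frame_hom_mono[OF F] by (auto simp: y_def intro: order_trans Sup_upper)
    have "saturated ?R y"
      using F_rel F unfolding saturated_def y by (auto simp: frame_hom_def)
    then have "saturation ?R x \<le> y"
      using saturation_le_iff[of ?R y x] y[of x] by simp
    then show "F (saturation ?R x) \<le> F x" by (simp add: y)
  qed
  define h where "h x = F (Rep_frame_of_reals x)" for x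
  have "frame_hom h"
    using F by (auto simp: frame_hom_def h_def top_frame_of_reals.rep_eq inf_frame_of_reals.rep_eq
        Sup_frame_of_reals.rep_eq F_sat image_image)
  moreover have "h (interval p q) = f p q" for p q
    by (simp add: h_def interval_def quot.rep_eq F_sat Fgen)
  ultimately show ?thesis
    by (intro ex1I[of _ h]) (auto intro: frame_hom_interval_unique)
qed

definition extend :: "(rat \<Rightarrow> rat \<Rightarrow> 'a::frame) \<Rightarrow> frame_of_reals \<Rightarrow> 'a" where
  "extend f = (THE h. frame_hom h \<and> (\<forall>p q. h (interval p q) = f p q))"

lemma frame_hom_extend: "satisfies_real_relations f \<Longrightarrow> frame_hom (extend f)"
  and extend_interval: "satisfies_real_relations f \<Longrightarrow> extend f (interval p q) = f p q"
  unfolding extend_def using theI'[OF ex1_frame_hom_extension[of f]] by blast+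

definition ray_above :: "rat \<Rightarrow> frame_of_reals" where
  "ray_above p = Sup {interval r s | r s. r > p \<and> s > p}"

definition ray_below :: "rat \<Rightarrow> frame_of_reals" where
  "ray_below q = Sup {interval r s | r s. r < q \<and> s < q}"

section \<open>Real-valued functions on a frame\<close>

definition RL :: "(frame_of_reals \<Rightarrow> 'a::frame) set" where
  "RL = {\<alpha>. frame_hom \<alpha>}"

definition rat_ivl :: "rat \<Rightarrow> rat \<Rightarrow> real set" where
  "rat_ivl p q = {of_rat p<..<of_rat q}"

definition RL_op :: "(real \<Rightarrow> real \<Rightarrow> real) \<Rightarrow>
    (frame_of_reals \<Rightarrow> 'a::frame) \<Rightarrow> (frame_of_reals \<Rightarrow> 'a) \<Rightarrow> frame_of_reals \<Rightarrow> 'a" where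
  "RL_op opr \<alpha> \<beta> = extend (\<lambda>p q. Sup {inf (\<alpha> (interval r s)) (\<beta> (interval u v)) | r s u v.
     {opr x y | x y. x \<in> rat_ivl r s \<and> y \<in> rat_ivl u v} \<subseteq> rat_ivl p q})"

text \<open>The additive inverse in the ring of real-valued functions.\<close>

definition RL_uminus :: "(frame_of_reals \<Rightarrow> 'a::frame) \<Rightarrow> frame_of_reals \<Rightarrow> 'a" where
  "RL_uminus \<alpha> = extend (\<lambda>p q. \<alpha> (interval (- q) (- p)))"

definition RL_minus ::
    "(frame_of_reals \<Rightarrow> 'a::frame) \<Rightarrow> (frame_of_reals \<Rightarrow> 'a) \<Rightarrow> frame_of_reals \<Rightarrow> 'a" where
  "RL_minus \<alpha> \<beta> = RL_op (+) \<alpha> (RL_uminus \<beta>)"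

definition RL_const :: "real \<Rightarrow> frame_of_reals \<Rightarrow> 'a::frame" where
  "RL_const r = extend (\<lambda>p q. if r \<in> rat_ivl p q then top else bot)"

text \<open>The functions to which \<^const>\<open>extend\<close> is applied in \<^const>\<open>RL_const\<close>, \<^const>\<open>RL_uminus\<close> and
  \<^term>\<open>RL_op (+)\<close> satisfy the relations, so that all of these are again elements of \<^const>\<open>RL\<close>.\<close>

lemma of_rat_max: "(of_rat (max x y) :: real) = max (of_rat x) (of_rat y)"
  and of_rat_min: "(of_rat (min x y) :: real) = min (of_rat x) (of_rat y)"
  by (simp_all add: max_def min_def of_rat_less_eq)

lemma RL_const_relations:
  "satisfies_real_relations (\<lambda>p q. if r \<in> rat_ivl p q then top else (bot :: 'a::frame))"
proof -
  define f :: "rat \<Rightarrow> rat \<Rightarrow> 'a" where "f p q = (if r \<in> rat_ivl p q then top else bot)" for p q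
  have top: "f p q = top" if "of_rat p < r" "r < of_rat q" for p q
    using that by (simp add: f_def rat_ivl_def)
  have bot: "f p q = bot" if "r \<le> of_rat p \<or> of_rat q \<le> r" for p q
    using that by (auto simp: f_def rat_ivl_def)
  have le: "(of_rat x :: real) \<le> of_rat y" if "x \<le> y" for x y
    using that by (simp add: of_rat_less_eq)
  have "inf (f p q) (f p' q') = f (max p p') (min q q')" for p q p' q'
    by (auto simp: f_def rat_ivl_def of_rat_max of_rat_min)
  moreover have "sup (f p q) (f p' q') = f p q'" if "p \<le> p'" "p' < q" "q \<le> q'" for p q p' q'
    using le[OF that(1)] le[OF that(3)] that(2)[folded of_rat_less[where 'a = real]]
    by (auto simp: f_def rat_ivl_def)
  moreover have "f p q = Sup {f p' q' | p' q'. p < p' \<and> p' < q' \<and> q' < q}" (is "_ = Sup ?S") for p q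
  proof (cases "of_rat p < r \<and> r < of_rat q")
    case True
    then obtain p' q' where *: "of_rat p < (of_rat p' :: real)" "of_rat p' < r"
        "r < of_rat q'" "of_rat q' < (of_rat q :: real)"
      using of_rat_dense[of "of_rat p" r] of_rat_dense[of r "of_rat q"] by blast
    then have "of_rat p' < (of_rat q' :: real)" by linarith
    with * have "f p' q' \<in> ?S"
      unfolding of_rat_less by blast
    then have "f p' q' \<le> Sup ?S"
      by (rule Sup_upper)
    then have "Sup ?S = top" using * by (simp add: top top_unique)
    then show ?thesis using True by (simp add: top)
  next
    case False
    have "f p' q' = bot" if "p < p'" "q' < q" for p' q'
      using le[of p p'] le[of q' q] that False by (intro bot) auto
    then have "Sup ?S \<le> bot"
      by (intro Sup_least) auto
    then show ?thesis using False by (simp add: bot bot_unique not_less)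
  qed
  moreover have "top = Sup {f p q | p q. True}"
  proof -
    obtain p q where "of_rat p < r" "r < of_rat q"
      using of_rat_dense[of "r - 1" r] of_rat_dense[of r "r + 1"] by auto
    then have "top = f p q" by (simp add: top)
    also have "\<dots> \<le> Sup {f p q | p q. True}" by (rule Sup_upper) blast
    finally show ?thesis by (simp add: top_unique)
  qed
  ultimately have "satisfies_real_relations f"
    unfolding satisfies_real_relations_iff by blast
  then show ?thesis unfolding f_def .
qed

lemma RL_const_in_RL: "RL_const r \<in> RL"
  unfolding RL_def RL_const_def using frame_hom_extend[OF RL_const_relations] by simp

lemma RL_uminus_relations:
  assumes "\<alpha> \<in> RL"
  shows "satisfies_real_relations (\<lambda>p q. \<alpha> (interval (- q) (- p)))"
proof -
  define f where "f p q = \<alpha> (interval p q)" for p q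
  have f: "satisfies_real_relations f"
    using assms frame_hom_satisfies_real_relations unfolding f_def RL_def by blast
  have 3: "{f r s | r s. - q < r \<and> r < s \<and> s < - p} =
      {f (- s) (- r) | r s. p < r \<and> r < s \<and> s < q}" (is "?A = ?B") for p q
  proof (intro equalityI subsetI)
    fix x assume "x \<in> ?A"
    then obtain r s where "x = f (- (- r)) (- (- s))" "p < - s" "- s < - r" "- r < q"
      by force
    then show "x \<in> ?B" by blast
  next
    fix x assume "x \<in> ?B"
    then obtain r s where "x = f (- s) (- r)" "- q < - s" "- s < - r" "- r < - p"
      by force
    then show "x \<in> ?A" by blast
  qed
  have 4: "{f p q | p q. True} = {f (- q) (- p) | p q. True}"
    by (auto; metis minus_minus)
  have "satisfies_real_relations (\<lambda>p q. f (- q) (- p))"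
    unfolding satisfies_real_relations_iff
  proof (intro conjI allI impI)
    fix p q r s
    show "inf (f (- q) (- p)) (f (- s) (- r)) = f (- min q s) (- max p r)"
      by (simp add: real_relations_inf[OF f] minus_max_eq_min minus_min_eq_max)
    show "sup (f (- q) (- p)) (f (- s) (- r)) = f (- s) (- p)" if "p \<le> r" "r < q" "q \<le> s"
      unfolding sup.commute[of "f (- q) (- p)"]
      by (rule real_relations_sup[OF f]) (use that in auto)
    show "f (- q) (- p) = Sup {f (- s) (- r) | r s. p < r \<and> r < s \<and> s < q}"
      unfolding 3[symmetric] by (rule real_relations_Sup[OF f])
  next
    show "top = Sup {f (- q) (- p) | p q. True}"
      by (simp only: 4[symmetric] real_relations_top[OF f])
  qed
  then show ?thesis by (simp add: f_def)
qed

lemma RL_uminus_in_RL: "\<alpha> \<in> RL \<Longrightarrow> RL_uminus \<alpha> \<in> RL"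
  unfolding RL_def RL_uminus_def using frame_hom_extend[OF RL_uminus_relations]
  by (simp add: RL_def)

lemma rat_ivl_add_subset_iff:
  assumes "r < s" "u < v"
  shows "{x + y | x y. x \<in> rat_ivl r s \<and> y \<in> rat_ivl u v} \<subseteq> rat_ivl p q \<longleftrightarrow> p \<le> r + u \<and> s + v \<le> q"
    (is "?A \<subseteq> _ \<longleftrightarrow> _")
proof
  define R S U V P Q where defs: "R = (of_rat r :: real)" "S = (of_rat s :: real)"
    "U = (of_rat u :: real)" "V = (of_rat v :: real)" "P = (of_rat p :: real)" "Q = (of_rat q :: real)"
  have RS: "R < S" "U < V" using assms by (simp_all add: defs of_rat_less)
  assume A: "?A \<subseteq> rat_ivl p q"
  have A: "P < x + y \<and> x + y < Q" if "R < x" "x < S" "U < y" "y < V" for x y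
  proof -
    have "x + y \<in> ?A" using that by (auto simp: rat_ivl_def defs)
    then have "x + y \<in> rat_ivl p q" by (rule subsetD[OF A])
    then show ?thesis by (simp add: rat_ivl_def defs)
  qed
  have "P \<le> R + U"
  proof (rule ccontr)
    assume "\<not> P \<le> R + U"
    define t where "t = min (min (S - R) (V - U)) (P - R - U) / 2"
    have "0 < t" "t < S - R" "t < V - U" "2 * t \<le> P - R - U"
      using RS \<open>\<not> P \<le> R + U\<close> by (auto simp: t_def min_def)
    then show False using A[of "R + t" "U + t"] by auto
  qed
  moreover have "S + V \<le> Q"
  proof (rule ccontr)
    assume "\<not> S + V \<le> Q"
    define t where "t = min (min (S - R) (V - U)) (S + V - Q) / 2"
    have "0 < t" "t < S - R" "t < V - U" "2 * t \<le> S + V - Q"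
      using RS \<open>\<not> S + V \<le> Q\<close> by (auto simp: t_def min_def)
    then show False using A[of "S - t" "V - t"] by auto
  qed
  ultimately show "p \<le> r + u \<and> s + v \<le> q"
    by (simp add: defs of_rat_add[symmetric] of_rat_less_eq)
next
  assume "p \<le> r + u \<and> s + v \<le> q"
  then have "of_rat p \<le> (of_rat r + of_rat u :: real)" "of_rat s + of_rat v \<le> (of_rat q :: real)"
    by (simp_all add: of_rat_add[symmetric] of_rat_less_eq)
  then show "?A \<subseteq> rat_ivl p q" by (auto simp: rat_ivl_def)
qed

lemma real_relations_mono:
  assumes "satisfies_real_relations f" "p' \<le> p" "q \<le> q'"
  shows "f p q \<le> f p' q'"
proof -
  have "inf (f p q) (f p' q') = f p q"
    using assms by (simp add: real_relations_inf max_absorb1 min_absorb1)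
  then show ?thesis by (metis inf.cobounded2)
qed

lemma real_relations_empty:
  assumes f: "satisfies_real_relations f" and "q \<le> p"
  shows "f p q = bot"
proof -
  have "f p q = Sup {f r s | r s. p < r \<and> r < s \<and> s < q}"
    by (rule real_relations_Sup[OF f])
  also have "{f r s | r s. p < r \<and> r < s \<and> s < q} = {}"
    using \<open>q \<le> p\<close> by auto
  finally show ?thesis by simp
qed

lemma real_relations_small:
  assumes f: "satisfies_real_relations f" and "0 < e"
  shows "f a b \<le> Sup {f a' b' | a' b'. a \<le> a' \<and> b' \<le> b \<and> b' - a' < e}" (is "_ \<le> Sup ?S")
proof -
  have step: "f c b \<le> Sup ?S" if "a \<le> c" "b - c < of_nat n * (e / 2)" for n c
    using that
  proof (induction n arbitrary: c)
    case 0
    then have "b \<le> c" by simp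
    then show ?case by (simp add: real_relations_empty[OF f])
  next
    case (Suc n)
    show ?case
    proof (cases "b - c < e")
      case True
      with Suc.prems show ?thesis by (intro Sup_upper) blast
    next
      case False
      have "f c b = sup (f c (c + 3 * e / 4)) (f (c + e / 2) b)"
        using False \<open>0 < e\<close> by (intro real_relations_sup[OF f, symmetric]) simp_all
      also have "\<dots> \<le> Sup ?S"
      proof (rule sup_least)
        have "a \<le> c \<and> c + 3 * e / 4 \<le> b \<and> (c + 3 * e / 4) - c < e"
          using Suc.prems False \<open>0 < e\<close> by simp
        then show "f c (c + 3 * e / 4) \<le> Sup ?S" by (intro Sup_upper) blast
        show "f (c + e / 2) b \<le> Sup ?S"
          using Suc.prems \<open>0 < e\<close> by (intro Suc.IH) (simp_all add: algebra_simps)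
      qed
      finally show ?thesis .
    qed
  qed
  obtain n where "(b - a) / (e / 2) < of_nat n"
    using reals_Archimedean2 by blast
  then have "b - a < of_nat n * (e / 2)"
    using \<open>0 < e\<close> by (simp add: pos_divide_less_eq)
  then show ?thesis by (rule step[OF order_refl])
qed

lemma RL_add_relations:
  assumes "\<alpha> \<in> RL" "\<beta> \<in> RL"
  shows "satisfies_real_relations (\<lambda>p q. Sup {inf (\<alpha> (interval r s)) (\<beta> (interval u v)) | r s u v.
     {x + y | x y. x \<in> rat_ivl r s \<and> y \<in> rat_ivl u v} \<subseteq> rat_ivl p q})"
proof -
  define f where "f p q = \<alpha> (interval p q)" for p q
  define g where "g p q = \<beta> (interval p q)" for p q
  have f: "satisfies_real_relations f" and g: "satisfies_real_relations g"
    using assms frame_hom_satisfies_real_relations unfolding f_def g_def RL_def by blast+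
  define h where "h p q = Sup {inf (f r s) (g u v) | r s u v. p \<le> r + u \<and> s + v \<le> q}" for p q
  have h_upper: "inf (f r s) (g u v) \<le> h p q" if "p \<le> r + u" "s + v \<le> q" for p q r s u v
    unfolding h_def using that by (intro Sup_upper) blast
  have h_least: "h p q \<le> x"
    if "\<And>r s u v. p \<le> r + u \<Longrightarrow> s + v \<le> q \<Longrightarrow> inf (f r s) (g u v) \<le> x" for p q x
    unfolding h_def using that by (intro Sup_least) auto
  have h_eq: "Sup {inf (f r s) (g u v) | r s u v.
     {x + y | x y. x \<in> rat_ivl r s \<and> y \<in> rat_ivl u v} \<subseteq> rat_ivl p q} = h p q" (is "Sup ?S = _") for p q
  proof (rule antisym)
    show "Sup ?S \<le> h p q"
    proof (rule Sup_least)
      fix x assume "x \<in> ?S"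
      then obtain r s u v where x: "x = inf (f r s) (g u v)"
        and sub: "{x + y | x y. x \<in> rat_ivl r s \<and> y \<in> rat_ivl u v} \<subseteq> rat_ivl p q"
        by blast
      show "x \<le> h p q"
      proof (cases "r < s \<and> u < v")
        case True
        with sub show ?thesis unfolding x by (intro h_upper) (simp_all add: rat_ivl_add_subset_iff)
      next
        case False
        then have "x = bot"
          using real_relations_empty[OF f, of s r] real_relations_empty[OF g, of v u]
          by (auto simp: x not_less)
        then show ?thesis by simp
      qed
    qed
    show "h p q \<le> Sup ?S"
    proof (rule h_least)
      fix r s u v assume rs: "p \<le> r + u" "s + v \<le> q"
      show "inf (f r s) (g u v) \<le> Sup ?S"
      proof (cases "r < s \<and> u < v")
        case True
        with rs have "{x + y | x y. x \<in> rat_ivl r s \<and> y \<in> rat_ivl u v} \<subseteq> rat_ivl p q"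
          by (simp add: rat_ivl_add_subset_iff)
        then show ?thesis by (intro Sup_upper) blast
      next
        case False
        then show ?thesis
          using real_relations_empty[OF f, of s r] real_relations_empty[OF g, of v u]
          by (auto simp: not_less)
      qed
    qed
  qed
  have h_mono: "h p q \<le> h p' q'" if "p' \<le> p" "q \<le> q'" for p q p' q'
    using that by (intro h_least h_upper) auto
  have "satisfies_real_relations h"
    unfolding satisfies_real_relations_iff
  proof (intro conjI allI impI)
    fix p q r s
    show "inf (h p q) (h r s) = h (max p r) (min q s)"
    proof (rule antisym)
      have "inf (inf (f a b) (g c d)) (inf (f a' b') (g c' d')) \<le> h (max p r) (min q s)"
        if "p \<le> a + c" "b + d \<le> q" "r \<le> a' + c'" "b' + d' \<le> s" for a b c d a' b' c' d'
      proof -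
        have "inf (inf (f a b) (g c d)) (inf (f a' b') (g c' d')) =
            inf (inf (f a b) (f a' b')) (inf (g c d) (g c' d'))"
          by (simp add: ac_simps)
        also have "\<dots> = inf (f (max a a') (min b b')) (g (max c c') (min d d'))"
          by (simp add: real_relations_inf[OF f] real_relations_inf[OF g])
        also have "\<dots> \<le> h (max p r) (min q s)"
          using that by (intro h_upper) (auto simp: max_def min_def)
        finally show ?thesis .
      qed
      then show "inf (h p q) (h r s) \<le> h (max p r) (min q s)"
        unfolding h_def[of p q] h_def[of r s] Sup_inf_frame inf_Sup_frame
        by (auto intro!: SUP_least)
      show "h (max p r) (min q s) \<le> inf (h p q) (h r s)"
        by (simp add: h_mono)
    qed
    show "sup (h p q) (h r s) = h p s" if "p \<le> r" "r < q" "q \<le> s"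
    proof (rule antisym)
      show "sup (h p q) (h r s) \<le> h p s"
        using that by (simp add: h_mono)
      show "h p s \<le> sup (h p q) (h r s)"
      proof (rule h_least)
        fix a b c d assume ab: "p \<le> a + c" "b + d \<le> s"
        define e where "e = (q - r) / 2"
        have "0 < e" using that by (simp add: e_def)
        have "inf (f a b) (g c d) \<le>
            inf (Sup {f a' b' | a' b'. a \<le> a' \<and> b' \<le> b \<and> b' - a' < e})
                (Sup {g c' d' | c' d'. c \<le> c' \<and> d' \<le> d \<and> d' - c' < e})"
          by (intro inf_mono real_relations_small[OF f \<open>0 < e\<close>] real_relations_small[OF g \<open>0 < e\<close>])
        also have "\<dots> \<le> sup (h p q) (h r s)"
        proof -
          have "inf (f a' b') (g c' d') \<le> sup (h p q) (h r s)"
            if "a \<le> a'" "b' \<le> b" "b' - a' < e" "c \<le> c'" "d' \<le> d" "d' - c' < e" for a' b' c' d'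
          proof (cases "b' + d' \<le> q")
            case True
            with that ab show ?thesis by (intro le_supI1 h_upper) auto
          next
            case False
            have "e + e = q - r" by (simp add: e_def)
            with False that ab show ?thesis by (intro le_supI2 h_upper) linarith+
          qed
          then show ?thesis
            unfolding Sup_inf_frame inf_Sup_frame by (auto intro!: SUP_least)
        qed
        finally show "inf (f a b) (g c d) \<le> sup (h p q) (h r s)" .
      qed
    qed
    show "h p q = Sup {h r s | r s. p < r \<and> r < s \<and> s < q}" (is "_ = Sup ?S")
    proof (rule antisym)
      show "Sup ?S \<le> h p q"
        by (intro Sup_least) (auto intro: h_mono)
      show "h p q \<le> Sup ?S"
      proof (rule h_least)
        fix a b c d assume ab: "p \<le> a + c" "b + d \<le> q"
        show "inf (f a b) (g c d) \<le> Sup ?S"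
        proof (cases "c < d")
          case True
          have "inf (f a' b') (g c d) \<le> Sup ?S" if "a < a'" "a' < b'" "b' < b" for a' b'
          proof -
            have "p < a' + c \<and> a' + c < b' + d \<and> b' + d < q"
              using that ab True by auto
            then have "h (a' + c) (b' + d) \<le> Sup ?S" by (intro Sup_upper) blast
            then show ?thesis using h_upper[of "a' + c" a' c b' d "b' + d"] by (meson order_refl order_trans)
          qed
          moreover have "f a b = Sup {f a' b' | a' b'. a < a' \<and> a' < b' \<and> b' < b}"
            by (rule real_relations_Sup[OF f])
          ultimately show ?thesis by (auto simp: Sup_inf_frame intro!: SUP_least)
        next
          case False
          then show ?thesis by (simp add: real_relations_empty[OF g])
        qed
      qed
    qed
  next
    have "top = inf (Sup {f p q | p q. True}) (Sup {g p q | p q. True})"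
      by (simp only: real_relations_top[OF f] real_relations_top[OF g] inf_top_left)
    also have "\<dots> \<le> Sup {h p q | p q. True}"
    proof -
      have "inf (f a b) (g c d) \<le> Sup {h p q | p q. True}" for a b c d
      proof -
        have "inf (f a b) (g c d) \<le> h (a + c) (b + d)" by (rule h_upper) simp_all
        also have "\<dots> \<le> Sup {h p q | p q. True}" by (rule Sup_upper) blast
        finally show ?thesis .
      qed
      then show ?thesis
        unfolding Sup_inf_frame inf_Sup_frame by (auto intro!: SUP_least)
    qed
    finally show "top = Sup {h p q | p q. True}" by (simp add: top_unique)
  qed
  moreover have "h = (\<lambda>p q. Sup {inf (f r s) (g u v) | r s u v.
     {x + y | x y. x \<in> rat_ivl r s \<and> y \<in> rat_ivl u v} \<subseteq> rat_ivl p q})"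
    by (intro ext) (rule h_eq[symmetric])
  ultimately show ?thesis by (simp add: f_def g_def)
qed

lemma RL_add_in_RL: "\<alpha> \<in> RL \<Longrightarrow> \<beta> \<in> RL \<Longrightarrow> RL_op (+) \<alpha> \<beta> \<in> RL"
  unfolding RL_op_def using frame_hom_extend[OF RL_add_relations[of \<alpha> \<beta>]]
  by (simp add: RL_def)

definition coz :: "(frame_of_reals \<Rightarrow> 'a::frame) \<Rightarrow> 'a" where
  "coz \<alpha> = sup (\<alpha> (ray_below 0)) (\<alpha> (ray_above 0))"

definition R_set :: "(frame_of_reals \<Rightarrow> 'a::frame) \<Rightarrow> real set" where
  "R_set \<alpha> = {r. coz (RL_minus \<alpha> (RL_const r)) \<noteq> top}"

definition C_c :: "(frame_of_reals \<Rightarrow> 'a::frame) set" where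
  "C_c = {\<alpha> \<in> RL. countable (R_set \<alpha>)}"

definition Coz_c :: "'a::frame set" where
  "Coz_c = {coz \<alpha> | \<alpha>. \<alpha> \<in> C_c}"

definition completely_regular :: "'a::frame itself \<Rightarrow> bool" where
  "completely_regular _ \<longleftrightarrow> (\<forall>a::'a. \<exists>S \<subseteq> {coz \<alpha> | \<alpha>. \<alpha> \<in> RL}. a = Sup S)"

section \<open>\<open>\<sigma>\<close>-frames\<close>

text \<open>Joins and meets are those of the poset \<open>L\<close> itself; \<open>S\<close> may be empty, so there is a least
  element. A greatest element is not required.\<close>

locale sigma_frame = lattice L for L (structure) +
  assumes meet_join_distrib:
      "\<lbrakk>x \<in> carrier L; y \<in> carrier L; z \<in> carrier L\<rbrakk> \<Longrightarrow> x \<sqinter> (y \<squnion> z) = (x \<sqinter> y) \<squnion> (x \<sqinter> z)"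
    and countable_sup_exists:
      "\<lbrakk>countable S; S \<subseteq> carrier L\<rbrakk> \<Longrightarrow> \<exists>s. least L s (Upper L S)"
    and meet_countable_sup:
      "\<lbrakk>a \<in> carrier L; countable S; S \<subseteq> carrier L\<rbrakk> \<Longrightarrow> a \<sqinter> \<Squnion>S = \<Squnion>((\<lambda>s. a \<sqinter> s) ` S)"

definition inherited_order :: "'a::order set \<Rightarrow> 'a gorder" where
  "inherited_order M = \<lparr>carrier = M, eq = (=), le = (\<le>)\<rparr>"

end

theory Submission
  imports Defs "HOL-Analysis.Continuum_Not_Denumerable"
begin

text \<open>The elements of \<open>Coz_c\<close> are exactly the joins of countably many complemented elements,
  and these are closed under countable joins and finite meets. If \<open>t\<close> is a real number outside
  \<open>R_set \<alpha>\<close>, then \<open>\<alpha>(-,t)\<close> and \<open>\<alpha>(t,-)\<close> are complements of each other; as \<open>R_set \<alpha>\<close> is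
  countable, its complement is dense, and \<open>coz \<alpha>\<close> is the join of countably many of these elements.
  Conversely, for complemented \<open>c 0, c 1, \<dots>\<close> with partial joins \<open>e n = c 0 \<squnion> \<dots> \<squnion> c (n - 1)\<close>, the
  function with value \<open>1/(n+1)\<close> on \<open>e (n+1) - e n\<close> and \<open>0\<close> off all the \<open>e n\<close> has the cozero element
  \<open>\<Squnion>n. c n\<close> and takes countably many values.\<close>

section \<open>Countable joins of complemented elements\<close>

\<comment> \<open>The frame law for a two-element set is binary distributivity, and in any lattice
  this yields the dual law.\<close>
subclass (in frame) distrib_lattice
proof
  fix x y z
  have *: "inf a (sup b c) = sup (inf a b) (inf a c)" for a b c
    using inf_Sup_frame[of a "{b, c}"] by simp
  show "sup x (inf y z) = inf (sup x y) (sup x z)"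
    by (rule distrib_imp1) (rule *)
qed

definition complemented :: "'a::bounded_lattice \<Rightarrow> bool" where
  "complemented c \<longleftrightarrow> (\<exists>d. inf c d = bot \<and> sup c d = top)"

definition countable_complemented_joins :: "'a::complete_lattice set" where
  "countable_complemented_joins = {Sup C | C. countable C \<and> (\<forall>c\<in>C. complemented c)}"

lemma complemented_bot: "complemented bot"
  unfolding complemented_def by (intro exI[of _ top]) simp

lemma complemented_inf:
  fixes a b :: "'a::frame"
  assumes "complemented a" "complemented b"
  shows "complemented (inf a b)"
proof -
  obtain a' b' where a: "inf a a' = bot" "sup a a' = top" and b: "inf b b' = bot" "sup b b' = top"
    using assms unfolding complemented_def by blast
  have "inf (inf a b) a' = bot" "inf (inf a b) b' = bot"
    using a(1) b(1) by (metis inf.assoc inf.commute inf_bot_right)+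
  then have "inf (inf a b) (sup a' b') = bot"
    by (simp add: inf_sup_distrib1)
  moreover have "sup a (sup a' b') = top" "sup b (sup a' b') = top"
    using a(2) b(2) by (metis sup.assoc sup.commute sup_top_right)+
  then have "sup (inf a b) (sup a' b') = top"
    by (simp add: sup_inf_distrib2)
  ultimately show ?thesis
    unfolding complemented_def by blast
qed

lemma complemented_sup:
  fixes a b :: "'a::frame"
  assumes "complemented a" "complemented b"
  shows "complemented (sup a b)"
proof -
  obtain a' b' where a: "inf a a' = bot" "sup a a' = top" and b: "inf b b' = bot" "sup b b' = top"
    using assms unfolding complemented_def by blast
  have "sup (sup a b) a' = top" "sup (sup a b) b' = top"
    using a(2) b(2) by (metis sup.assoc sup.commute sup_top_right)+
  then have "sup (sup a b) (inf a' b') = top"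
    by (simp add: sup_inf_distrib1)
  moreover have "inf a (inf a' b') = bot" "inf b (inf a' b') = bot"
    using a(1) b(1) by (metis inf.assoc inf.commute inf_bot_right)+
  then have "inf (sup a b) (inf a' b') = bot"
    by (simp add: inf_sup_distrib2)
  ultimately show ?thesis
    unfolding complemented_def by blast
qed

lemma complemented_finite_Sup:
  fixes A :: "'a::frame set"
  assumes "finite A" "\<And>a. a \<in> A \<Longrightarrow> complemented a"
  shows "complemented (Sup A)"
  using assms by (induction A) (auto simp: complemented_bot complemented_sup)

text \<open>Since binary meets distribute over arbitrary joins, the meet of two such joins is the
  join of the pairwise meets, a countable family of complemented elements.\<close>

lemma inf_in_countable_complemented_joins:
  fixes a b :: "'a::frame"
  assumes "a \<in> countable_complemented_joins" "b \<in> countable_complemented_joins"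
  shows "inf a b \<in> countable_complemented_joins"
proof -
  obtain A B where A: "a = Sup A" "countable A" "\<forall>c\<in>A. complemented c"
    and B: "b = Sup B" "countable B" "\<forall>c\<in>B. complemented c"
    using assms unfolding countable_complemented_joins_def by blast
  let ?C = "(\<lambda>(x, y). inf x y) ` (A \<times> B)"
  have "inf a b = Sup ?C"
    unfolding A B Sup_inf_frame inf_Sup_frame
    by (rule antisym) (auto intro!: SUP_least intro: Sup_upper SUP_upper2)
  moreover have "countable ?C" "\<forall>c\<in>?C. complemented c"
    using A B by (auto intro: complemented_inf)
  ultimately show ?thesis
    unfolding countable_complemented_joins_def by blast
qed

lemma Sup_in_countable_complemented_joins:
  assumes "countable S" "S \<subseteq> countable_complemented_joins"
  shows "Sup S \<in> countable_complemented_joins"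
proof -
  have "\<forall>s\<in>S. \<exists>C. s = Sup C \<and> countable C \<and> (\<forall>c\<in>C. complemented c)"
    using assms(2) unfolding countable_complemented_joins_def by blast
  then obtain C where C: "\<And>s. s \<in> S \<Longrightarrow> s = Sup (C s)" "\<And>s. s \<in> S \<Longrightarrow> countable (C s)"
      "\<And>s. s \<in> S \<Longrightarrow> \<forall>c\<in>C s. complemented c"
    by metis
  have "Sup S = (SUP s\<in>S. Sup (C s))"
    by (simp add: C(1)[symmetric])
  also have "\<dots> = Sup (\<Union>s\<in>S. C s)"
    using SUP_UNION[of "\<lambda>x. x" C S] by simp
  finally show ?thesis
    unfolding countable_complemented_joins_def using C assms(1) by blast
qed

section \<open>Cuts of a real-valued function\<close>

text \<open>This is \<alpha>(-,t) for a real \<open>t\<close>. For \<open>\<alpha> \<in> RL\<close>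
  the weak bound on \<open>q\<close> gives the same join as the strict one, since (R3) approximates
  each interval from inside. In the same way \<open>upper_cut\<close> is \<alpha>(t,-).\<close>

definition lower_cut :: "(frame_of_reals \<Rightarrow> 'a::frame) \<Rightarrow> real \<Rightarrow> 'a" where
  "lower_cut \<alpha> t = Sup {\<alpha> (interval p q) | p q. of_rat q \<le> t}"

definition upper_cut :: "(frame_of_reals \<Rightarrow> 'a::frame) \<Rightarrow> real \<Rightarrow> 'a" where
  "upper_cut \<alpha> t = Sup {\<alpha> (interval p q) | p q. t \<le> of_rat p}"

lemma lower_cut_upper: "of_rat q \<le> t \<Longrightarrow> \<alpha> (interval p q) \<le> lower_cut \<alpha> t"
  unfolding lower_cut_def by (rule Sup_upper) blast

lemma upper_cut_upper: "t \<le> of_rat p \<Longrightarrow> \<alpha> (interval p q) \<le> upper_cut \<alpha> t"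
  unfolding upper_cut_def by (rule Sup_upper) blast

lemma RL_relations: "\<alpha> \<in> RL \<Longrightarrow> satisfies_real_relations (\<lambda>p q. \<alpha> (interval p q))"
  by (simp add: RL_def frame_hom_satisfies_real_relations)

text \<open>This is how (R3) is applied: an upper bound has to be checked only on intervals strictly
  inside, which turns weak inequalities between endpoints into strict ones.\<close>

lemma RL_interval_le:
  assumes "\<alpha> \<in> RL"
    and "\<And>p' q'. p < p' \<Longrightarrow> p' < q' \<Longrightarrow> q' < q \<Longrightarrow> \<alpha> (interval p' q') \<le> x"
  shows "\<alpha> (interval p q) \<le> x"
proof -
  have "\<alpha> (interval p q) = Sup {\<alpha> (interval r s) | r s. p < r \<and> r < s \<and> s < q}"
    by (rule real_relations_Sup[OF RL_relations[OF assms(1)]])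
  also have "\<dots> \<le> x"
    using assms(2) by (auto intro!: Sup_least)
  finally show ?thesis .
qed

text \<open>The rays demand that both endpoints lie strictly on one side of 0, the cuts only that
  one of them lies weakly there; shrinking an interval by (R3) bridges the difference.\<close>

lemma coz_eq_cuts:
  assumes \<alpha>: "\<alpha> \<in> RL"
  shows "coz \<alpha> = sup (lower_cut \<alpha> 0) (upper_cut \<alpha> 0)"
proof -
  have Sup: "\<alpha> (Sup S) = Sup (\<alpha> ` S)" for S
    using \<alpha> by (simp add: RL_def frame_hom_def)
  have "\<alpha> (ray_below 0) = lower_cut \<alpha> 0"
  proof (rule antisym)
    show "\<alpha> (ray_below 0) \<le> lower_cut \<alpha> 0"
      unfolding ray_below_def Sup by (auto intro!: SUP_least lower_cut_upper)
    have "\<alpha> (interval p q) \<le> \<alpha> (ray_below 0)" if "q \<le> 0" for p q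
    proof (rule RL_interval_le[OF \<alpha>])
      fix p' q' assume "p < p'" "p' < q'" "q' < q"
      then have "p' < 0" "q' < 0" using that by simp_all
      then show "\<alpha> (interval p' q') \<le> \<alpha> (ray_below 0)"
        unfolding ray_below_def Sup by (intro SUP_upper) blast
    qed
    then show "lower_cut \<alpha> 0 \<le> \<alpha> (ray_below 0)"
      unfolding lower_cut_def by (auto intro!: Sup_least)
  qed
  moreover have "\<alpha> (ray_above 0) = upper_cut \<alpha> 0"
  proof (rule antisym)
    show "\<alpha> (ray_above 0) \<le> upper_cut \<alpha> 0"
      unfolding ray_above_def Sup by (auto intro!: SUP_least upper_cut_upper)
    have "\<alpha> (interval p q) \<le> \<alpha> (ray_above 0)" if "0 \<le> p" for p q
    proof (rule RL_interval_le[OF \<alpha>])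
      fix p' q' assume "p < p'" "p' < q'" "q' < q"
      then have "p' > 0" "q' > 0" using that by simp_all
      then show "\<alpha> (interval p' q') \<le> \<alpha> (ray_above 0)"
        unfolding ray_above_def Sup by (intro SUP_upper) blast
    qed
    then show "upper_cut \<alpha> 0 \<le> \<alpha> (ray_above 0)"
      unfolding upper_cut_def by (auto intro!: Sup_least)
  qed
  ultimately show ?thesis by (simp add: coz_def)
qed

section \<open>Subtraction of a constant\<close>

text \<open>Subtracting \<open>t\<close> moves the question from (p, q) to (p + t, q + t). As
  \<open>t\<close> may be irrational, these endpoints need not be rational, so the value is a join
  over rational intervals inside.\<close>

lemma RL_minus_const_interval:
  assumes \<alpha>: "\<alpha> \<in> RL"
  shows "RL_minus \<alpha> (RL_const t) (interval p q) =
    Sup {\<alpha> (interval a b) | a b. of_rat p + t \<le> of_rat a \<and> of_rat b \<le> of_rat q + t}"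
    (is "_ = Sup ?S")
proof -
  let ?\<gamma> = "RL_uminus (RL_const t) :: frame_of_reals \<Rightarrow> 'a"
  let ?T = "{inf (\<alpha> (interval r s)) (?\<gamma> (interval u v)) | r s u v.
     {x + y | x y. x \<in> rat_ivl r s \<and> y \<in> rat_ivl u v} \<subseteq> rat_ivl p q}"
  have \<gamma>: "?\<gamma> (interval u v) = (if - t \<in> rat_ivl u v then top else bot)" for u v
  proof -
    have "- t \<in> rat_ivl u v \<longleftrightarrow> t \<in> rat_ivl (- v) (- u)"
      by (auto simp: rat_ivl_def of_rat_minus)
    then show ?thesis
      unfolding RL_uminus_def extend_interval[OF RL_uminus_relations[OF RL_const_in_RL]]
      by (simp add: RL_const_def extend_interval[OF RL_const_relations])
  qed
  have "RL_minus \<alpha> (RL_const t) (interval p q) = Sup ?T"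
    unfolding RL_minus_def RL_op_def
    by (rule extend_interval[OF RL_add_relations[OF \<alpha> RL_uminus_in_RL[OF RL_const_in_RL]]])
  also have "Sup ?T = Sup ?S"
  proof (rule antisym)
    show "Sup ?T \<le> Sup ?S"
    proof (rule Sup_least)
      fix z assume "z \<in> ?T"
      then obtain r s u v where z: "z = inf (\<alpha> (interval r s)) (?\<gamma> (interval u v))"
        and sub: "{x + y | x y. x \<in> rat_ivl r s \<and> y \<in> rat_ivl u v} \<subseteq> rat_ivl p q"
        by blast
      \<comment> \<open>In the first two cases one of the factors is \<open>bot\<close>; the third
        leaves nonempty intervals, for which containment of the sum amounts to inequalities between
        endpoints.\<close>
      consider "s \<le> r" | "- t \<notin> rat_ivl u v" | "r < s" "- t \<in> rat_ivl u v" by fastforce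
      then show "z \<le> Sup ?S"
      proof cases
        case 1
        then show ?thesis by (simp add: z real_relations_empty[OF RL_relations[OF \<alpha>]])
      next
        case 2
        then show ?thesis by (simp add: z \<gamma>)
      next
        case 3
        then have uv: "of_rat u < - t" "- t < of_rat v" by (auto simp: rat_ivl_def)
        then have "u < v" by (metis of_rat_less order_less_trans)
        with sub 3 have "p \<le> r + u" "s + v \<le> q" by (simp_all add: rat_ivl_add_subset_iff)
        then have "of_rat p \<le> (of_rat r + of_rat u :: real)" "of_rat s + of_rat v \<le> (of_rat q :: real)"
          by (simp_all add: of_rat_add[symmetric] of_rat_less_eq)
        with uv have "of_rat p + t \<le> of_rat r" "of_rat s \<le> of_rat q + t" by linarith+
        then have "\<alpha> (interval r s) \<le> Sup ?S" by (intro Sup_upper) blast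
        then show ?thesis by (simp add: z le_infI1)
      qed
    qed
    show "Sup ?S \<le> Sup ?T"
    proof (rule Sup_least)
      fix z assume "z \<in> ?S"
      then obtain a b where z: "z = \<alpha> (interval a b)"
        and ab: "of_rat p + t \<le> of_rat a" "of_rat b \<le> of_rat q + t"
        by blast
      show "z \<le> Sup ?T"
        unfolding z
      proof (rule RL_interval_le[OF \<alpha>])
        fix a' b' assume "a < a'" "a' < b'" "b' < b"
        then have "of_rat a < (of_rat a' :: real)" "of_rat b' < (of_rat b :: real)"
          by (simp_all add: of_rat_less)
        \<comment> \<open>Having passed to \<open>a'\<close> and \<open>b'\<close>, both
          inequalities are strict; this leaves room for rationals \<open>u\<close> and
          \<open>v\<close> around \<open>- t\<close> such that the sum of the two intervals stays
          within (p, q).\<close>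
        with ab have "of_rat p - of_rat a' < - t" "- t < of_rat q - of_rat b'" by linarith+
        then obtain u v where uv: "of_rat p - of_rat a' < (of_rat u :: real)" "of_rat u < - t"
            "- t < of_rat v" "of_rat v < (of_rat q - of_rat b' :: real)"
          by (meson of_rat_dense)
        then have "{x + y | x y. x \<in> rat_ivl a' b' \<and> y \<in> rat_ivl u v} \<subseteq> rat_ivl p q"
          by (auto simp: rat_ivl_def)
        then have "inf (\<alpha> (interval a' b')) (?\<gamma> (interval u v)) \<le> Sup ?T"
          by (intro Sup_upper) blast
        moreover have "?\<gamma> (interval u v) = top"
          using uv by (simp add: \<gamma> rat_ivl_def)
        ultimately show "\<alpha> (interval a' b') \<le> Sup ?T" by simp
      qed
    qed
  qed
  finally show ?thesis .
qed

text \<open>The cuts of \<alpha> - t at 0 are the cuts of \<alpha> at \<open>t\<close>: an interval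
  of \<alpha> below \<open>t\<close> is caught by the interval (p, 0) of \<alpha> - t once
  \<open>p\<close> is small enough, and dually above.\<close>

lemma coz_minus_const:
  assumes \<alpha>: "\<alpha> \<in> RL"
  shows "coz (RL_minus \<alpha> (RL_const t)) = sup (lower_cut \<alpha> t) (upper_cut \<alpha> t)"
proof -
  let ?\<beta> = "RL_minus \<alpha> (RL_const t)"
  have \<beta>: "?\<beta> \<in> RL"
    unfolding RL_minus_def by (rule RL_add_in_RL[OF \<alpha> RL_uminus_in_RL[OF RL_const_in_RL]])
  note eq = RL_minus_const_interval[OF \<alpha>, of t]
  have "lower_cut ?\<beta> 0 = lower_cut \<alpha> t"
  proof (rule antisym)
    have "\<alpha> (interval a b) \<le> lower_cut \<alpha> t"
      if "of_rat q \<le> (0::real)" "of_rat b \<le> of_rat q + t" for a b q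
      using that by (intro lower_cut_upper) linarith
    then show "lower_cut ?\<beta> 0 \<le> lower_cut \<alpha> t"
      unfolding lower_cut_def[of ?\<beta>] eq by (blast intro!: Sup_least)
    have "\<alpha> (interval a b) \<le> lower_cut ?\<beta> 0" if "of_rat b \<le> t" for a b
    proof -
      obtain p where "of_rat p < of_rat a - t"
        using of_rat_dense[of "of_rat a - t - 1" "of_rat a - t"] by auto
      then have "of_rat p + t \<le> of_rat a" "of_rat b \<le> of_rat 0 + t" using that by simp_all
      then have "\<alpha> (interval a b) \<le> ?\<beta> (interval p 0)"
        unfolding eq by (intro Sup_upper) blast
      also have "\<dots> \<le> lower_cut ?\<beta> 0" by (rule lower_cut_upper) simp
      finally show ?thesis .
    qed
    then show "lower_cut \<alpha> t \<le> lower_cut ?\<beta> 0"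
      unfolding lower_cut_def[of \<alpha>] by (auto intro!: Sup_least)
  qed
  moreover have "upper_cut ?\<beta> 0 = upper_cut \<alpha> t"
  proof (rule antisym)
    have "\<alpha> (interval a b) \<le> upper_cut \<alpha> t"
      if "(0::real) \<le> of_rat p" "of_rat p + t \<le> of_rat a" for a b p
      using that by (intro upper_cut_upper) linarith
    then show "upper_cut ?\<beta> 0 \<le> upper_cut \<alpha> t"
      unfolding upper_cut_def[of ?\<beta>] eq by (blast intro!: Sup_least)
    have "\<alpha> (interval a b) \<le> upper_cut ?\<beta> 0" if "t \<le> of_rat a" for a b
    proof -
      obtain q where "of_rat b - t < of_rat q"
        using of_rat_dense[of "of_rat b - t" "of_rat b - t + 1"] by auto
      then have "of_rat 0 + t \<le> of_rat a" "of_rat b \<le> of_rat q + t" using that by simp_all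
      then have "\<alpha> (interval a b) \<le> ?\<beta> (interval 0 q)"
        unfolding eq by (intro Sup_upper) blast
      also have "\<dots> \<le> upper_cut ?\<beta> 0" by (rule upper_cut_upper) simp
      finally show ?thesis .
    qed
    then show "upper_cut \<alpha> t \<le> upper_cut ?\<beta> 0"
      unfolding upper_cut_def[of \<alpha>] by (auto intro!: Sup_least)
  qed
  ultimately show ?thesis by (simp add: coz_eq_cuts[OF \<beta>])
qed

section \<open>Complementary cuts and approximation by a dense set of reals\<close>

lemma R_set_iff: "\<alpha> \<in> RL \<Longrightarrow> t \<in> R_set \<alpha> \<longleftrightarrow> sup (lower_cut \<alpha> t) (upper_cut \<alpha> t) \<noteq> top"
  by (simp add: R_set_def coz_minus_const)

text \<open>By (R1), intervals on opposite sides of \<open>t\<close> meet in an interval with no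
  room between its endpoints, which is \<open>bot\<close> by (R3).\<close>

lemma inf_cuts:
  assumes \<alpha>: "\<alpha> \<in> RL"
  shows "inf (lower_cut \<alpha> t) (upper_cut \<alpha> t) = bot"
proof -
  have "inf (\<alpha> (interval p q)) (\<alpha> (interval p' q')) = bot" if "of_rat q \<le> t" "t \<le> of_rat p'" for p q p' q'
  proof -
    have "q \<le> p'" using that by (metis of_rat_less_eq order_trans)
    then have "min q q' \<le> max p p'" by linarith
    then show ?thesis
      by (simp add: real_relations_inf[OF RL_relations[OF \<alpha>]] real_relations_empty[OF RL_relations[OF \<alpha>]])
  qed
  then show ?thesis
    unfolding lower_cut_def upper_cut_def Sup_inf_frame inf_Sup_frame
    by (auto intro!: antisym[OF _ bot_least] SUP_least)
qed

lemma complemented_cuts: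
  assumes "\<alpha> \<in> RL" "t \<notin> R_set \<alpha>"
  shows "complemented (lower_cut \<alpha> t)" "complemented (upper_cut \<alpha> t)"
  using assms inf_cuts[OF assms(1)] unfolding complemented_def
  by (metis R_set_iff inf.commute sup.commute)+

lemma lower_cut_mono: "s \<le> t \<Longrightarrow> lower_cut \<alpha> s \<le> lower_cut \<alpha> t"
  unfolding lower_cut_def by (rule Sup_subset_mono) fastforce

lemma upper_cut_antimono: "s \<le> t \<Longrightarrow> upper_cut \<alpha> t \<le> upper_cut \<alpha> s"
  unfolding upper_cut_def by (rule Sup_subset_mono) fastforce

text \<open>Shrinking an interval by (R3) separates it from \<open>t\<close>, and \<open>D\<close>
  has a point in the gap. Here \<open>t\<close> is arbitrary, so the cuts at 0 can be reached even
  when 0 lies in \<open>R_set \<alpha>\<close>.\<close>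

lemma cuts_eq_Sup_dense:
  assumes \<alpha>: "\<alpha> \<in> RL" and D: "\<And>x y. x < y \<Longrightarrow> \<exists>s\<in>D. x < s \<and> s < y"
  shows "lower_cut \<alpha> t = Sup (lower_cut \<alpha> ` {s\<in>D. s < t})"
    and "upper_cut \<alpha> t = Sup (upper_cut \<alpha> ` {s\<in>D. t < s})"
proof -
  have "\<alpha> (interval p q) \<le> Sup (lower_cut \<alpha> ` {s\<in>D. s < t})" if q: "of_rat q \<le> t" for p q
  proof (rule RL_interval_le[OF \<alpha>])
    fix p' q' assume "q' < q"
    then have "of_rat q' < t" using q by (meson of_rat_less less_le_trans)
    then obtain s where s: "s \<in> D" "of_rat q' < s" "s < t" using D by blast
    then have "\<alpha> (interval p' q') \<le> lower_cut \<alpha> s" by (intro lower_cut_upper) simp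
    also have "\<dots> \<le> Sup (lower_cut \<alpha> ` {s\<in>D. s < t})" using s by (intro SUP_upper) simp
    finally show "\<alpha> (interval p' q') \<le> Sup (lower_cut \<alpha> ` {s\<in>D. s < t})" .
  qed
  then have "lower_cut \<alpha> t \<le> Sup (lower_cut \<alpha> ` {s\<in>D. s < t})"
    unfolding lower_cut_def[of \<alpha> t] by (auto intro!: Sup_least)
  then show "lower_cut \<alpha> t = Sup (lower_cut \<alpha> ` {s\<in>D. s < t})"
    by (auto intro!: antisym SUP_least lower_cut_mono)
  have "\<alpha> (interval p q) \<le> Sup (upper_cut \<alpha> ` {s\<in>D. t < s})" if p: "t \<le> of_rat p" for p q
  proof (rule RL_interval_le[OF \<alpha>])
    fix p' q' assume "p < p'"
    then have "t < of_rat p'" using p by (meson of_rat_less le_less_trans)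
    then obtain s where s: "s \<in> D" "t < s" "s < of_rat p'" using D by blast
    then have "\<alpha> (interval p' q') \<le> upper_cut \<alpha> s" by (intro upper_cut_upper) simp
    also have "\<dots> \<le> Sup (upper_cut \<alpha> ` {s\<in>D. t < s})" using s by (intro SUP_upper) simp
    finally show "\<alpha> (interval p' q') \<le> Sup (upper_cut \<alpha> ` {s\<in>D. t < s})" .
  qed
  then have "upper_cut \<alpha> t \<le> Sup (upper_cut \<alpha> ` {s\<in>D. t < s})"
    unfolding upper_cut_def[of \<alpha> t] by (auto intro!: Sup_least)
  then show "upper_cut \<alpha> t = Sup (upper_cut \<alpha> ` {s\<in>D. t < s})"
    by (auto intro!: antisym SUP_least upper_cut_antimono)
qed

text \<open>An open interval is uncountable, so every interval with rational endpoints contains a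
  point outside \<open>R\<close>; choosing one point for each of these countably many intervals
  gives \<open>D\<close>.\<close>

lemma countable_dense_avoiding_countable:
  fixes R :: "real set"
  assumes "countable R"
  obtains D where "countable D" "D \<inter> R = {}" "\<And>x y. x < y \<Longrightarrow> \<exists>s\<in>D. x < s \<and> s < y"
proof -
  define P where "P = {z :: rat \<times> rat. fst z < snd z}"
  have "\<exists>s. of_rat (fst z) < s \<and> s < of_rat (snd z) \<and> s \<notin> R" if "z \<in> P" for z
    using that real_interval_avoid_countable_set[OF _ assms, of "of_rat (fst z)" "of_rat (snd z)"]
    by (auto simp: P_def of_rat_less)
  then obtain f where f: "\<And>z. z \<in> P \<Longrightarrow> of_rat (fst z) < f z \<and> f z < of_rat (snd z) \<and> f z \<notin> R"
    by metis
  have "\<exists>s\<in>f ` P. x < s \<and> s < y" if "x < y" for x y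
  proof -
    obtain a b where ab: "x < of_rat a" "of_rat a < (of_rat b :: real)" "of_rat b < y"
      using of_rat_dense \<open>x < y\<close> by meson
    then have "(a, b) \<in> P" by (simp add: P_def of_rat_less)
    with f[OF this] ab show ?thesis by (auto intro!: bexI[of _ "(a, b)"])
  qed
  moreover have "countable (f ` P)" by simp
  moreover have "f ` P \<inter> R = {}" using f by blast
  ultimately show ?thesis using that by blast
qed

lemma Coz_c_subset: "Coz_c \<subseteq> countable_complemented_joins"
proof
  fix a :: 'a assume "a \<in> Coz_c"
  then obtain \<alpha> where a: "a = coz \<alpha>" and \<alpha>: "\<alpha> \<in> RL" and "countable (R_set \<alpha>)"
    unfolding Coz_c_def C_c_def by blast
  then obtain D where D: "countable D" "D \<inter> R_set \<alpha> = {}" "\<And>x y. x < y \<Longrightarrow> \<exists>s\<in>D. x < s \<and> s < y"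
    using countable_dense_avoiding_countable by metis
  let ?C = "lower_cut \<alpha> ` {s\<in>D. s < 0} \<union> upper_cut \<alpha> ` {s\<in>D. 0 < s}"
  have "a = Sup ?C"
    by (simp add: a coz_eq_cuts[OF \<alpha>] cuts_eq_Sup_dense[OF \<alpha> D(3), of 0] Sup_union_distrib)
  moreover have "countable ?C" using D(1) by simp
  moreover have "\<forall>c\<in>?C. complemented c"
    using D(2) complemented_cuts[OF \<alpha>] by auto
  ultimately show "a \<in> countable_complemented_joins"
    unfolding countable_complemented_joins_def by blast
qed

section \<open>Real-valued functions from scales\<close>

text \<open>\<open>U p\<close> and \<open>D q\<close> prescribe the values at the rays (p,-) and
  (-,q). The axioms \<open>U_Sup\<close> and \<open>D_Sup\<close> account for (R3),
  \<open>cover\<close> for (R2), \<open>U_top\<close> and \<open>D_top\<close> for (R4);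
  \<open>disjoint\<close> makes the empty intervals \<open>bot\<close>.\<close>

locale scale =
  fixes U D :: "rat \<Rightarrow> 'a::frame"
  assumes U_Sup: "\<And>p. U p = Sup (U ` {p<..})"
    and D_Sup: "\<And>q. D q = Sup (D ` {..<q})"
    and disjoint: "\<And>p q. q \<le> p \<Longrightarrow> inf (U p) (D q) = bot"
    and cover: "\<And>p q. p < q \<Longrightarrow> sup (U p) (D q) = top"
    and U_top: "Sup (range U) = top"
    and D_top: "Sup (range D) = top"
begin

lemma U_antimono: "p \<le> q \<Longrightarrow> U q \<le> U p"
  by (metis U_Sup SUP_upper greaterThan_iff order_refl le_less)

lemma D_mono: "p \<le> q \<Longrightarrow> D p \<le> D q"
  by (metis D_Sup SUP_upper lessThan_iff order_refl le_less)

lemma scale_relations: "satisfies_real_relations (\<lambda>p q. inf (U p) (D q))"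
  unfolding satisfies_real_relations_iff
proof (intro conjI allI impI)
  fix p q r s
  have "inf (U p) (U r) = U (max p r)"
    using U_antimono[of p r] U_antimono[of r p] by (auto simp: max_def inf.absorb1 inf.absorb2)
  moreover have "inf (D q) (D s) = D (min q s)"
    using D_mono[of q s] D_mono[of s q] by (auto simp: min_def inf.absorb1 inf.absorb2)
  ultimately show "inf (inf (U p) (D q)) (inf (U r) (D s)) = inf (U (max p r)) (D (min q s))"
    by (metis inf.assoc inf.left_commute)
  show "sup (inf (U p) (D q)) (inf (U r) (D s)) = inf (U p) (D s)" if "p \<le> r" "r < q" "q \<le> s"
  proof (rule antisym)
    show "sup (inf (U p) (D q)) (inf (U r) (D s)) \<le> inf (U p) (D s)"
      using that by (meson U_antimono D_mono inf_mono sup_least order_refl)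
    \<comment> \<open>Since \<open>sup (U r) (D q) = top\<close>, the meet splits into a part in
      \<open>U r\<close> and a part in \<open>D q\<close>.\<close>
    have "inf (U p) (D s) = inf (inf (U p) (D s)) (sup (U r) (D q))"
      using cover[OF that(2)] by simp
    also have "\<dots> = sup (inf (inf (U p) (U r)) (D s)) (inf (U p) (inf (D s) (D q)))"
      by (simp add: inf_sup_distrib1 ac_simps)
    also have "\<dots> \<le> sup (inf (U r) (D s)) (inf (U p) (D q))"
      by (intro sup_mono inf_mono) simp_all
    finally show "inf (U p) (D s) \<le> sup (inf (U p) (D q)) (inf (U r) (D s))"
      by (simp add: sup.commute)
  qed
  show "inf (U p) (D q) = Sup {inf (U r) (D s) | r s. p < r \<and> r < s \<and> s < q}" (is "_ = Sup ?S")
  proof (rule antisym)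
    show "Sup ?S \<le> inf (U p) (D q)"
      by (intro Sup_least) (auto intro!: le_infI1[OF U_antimono] le_infI2[OF D_mono])
    \<comment> \<open>The restriction \<open>r < s\<close> loses nothing: pairs with
      \<open>s \<le> r\<close> contribute \<open>bot\<close> by \<open>disjoint\<close>.\<close>
    have "inf (U r) (D s) \<le> Sup ?S" if "p < r" "s < q" for r s
    proof (cases "r < s")
      case True
      with that show ?thesis by (intro Sup_upper) blast
    next
      case False
      then show ?thesis by (simp add: disjoint)
    qed
    then show "inf (U p) (D q) \<le> Sup ?S"
      unfolding U_Sup[of p] D_Sup[of q] by (auto simp: Sup_inf_frame inf_Sup_frame intro!: SUP_least)
  qed
next
  have "top = inf (Sup (range U)) (Sup (range D))"
    by (simp add: U_top D_top)
  also have "\<dots> \<le> Sup {inf (U p) (D q) | p q. True}"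
    unfolding Sup_inf_frame inf_Sup_frame by (auto intro!: SUP_least intro: Sup_upper)
  finally show "top = Sup {inf (U p) (D q) | p q. True}"
    by (simp add: top_unique)
qed

definition fn :: "frame_of_reals \<Rightarrow> 'a" where
  "fn = extend (\<lambda>p q. inf (U p) (D q))"

lemma fn_in_RL: "fn \<in> RL"
  by (simp add: RL_def fn_def frame_hom_extend[OF scale_relations])

lemma fn_interval: "fn (interval p q) = inf (U p) (D q)"
  by (simp add: fn_def extend_interval[OF scale_relations])

text \<open>The values \<open>U p\<close> join to \<open>top\<close>, so joining
  \<open>inf (U p) (D q)\<close> over all \<open>p\<close> leaves \<open>D q\<close>.\<close>

lemma lower_cut_fn: "lower_cut fn t = Sup {D q | q. of_rat q \<le> t}"
proof (rule antisym)
  show "lower_cut fn t \<le> Sup {D q | q. of_rat q \<le> t}"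
    unfolding lower_cut_def fn_interval by (auto intro!: Sup_least intro: le_infI2 Sup_upper)
  have "D q \<le> lower_cut fn t" if "of_rat q \<le> t" for q
  proof -
    have "D q = (SUP p. fn (interval p q))"
      by (simp add: fn_interval U_top Sup_inf_frame[of "range U", unfolded image_image, symmetric])
    also have "\<dots> \<le> lower_cut fn t"
      using that by (intro SUP_least lower_cut_upper)
    finally show ?thesis .
  qed
  then show "Sup {D q | q. of_rat q \<le> t} \<le> lower_cut fn t"
    by (auto intro!: Sup_least)
qed

lemma upper_cut_fn: "upper_cut fn t = Sup {U p | p. t \<le> of_rat p}"
proof (rule antisym)
  show "upper_cut fn t \<le> Sup {U p | p. t \<le> of_rat p}"
    unfolding upper_cut_def fn_interval by (auto intro!: Sup_least intro: le_infI1 Sup_upper)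
  have "U p \<le> upper_cut fn t" if "t \<le> of_rat p" for p
  proof -
    have "U p = (SUP q. fn (interval p q))"
      by (simp add: fn_interval D_top inf_Sup_frame[of _ "range D", unfolded image_image, symmetric])
    also have "\<dots> \<le> upper_cut fn t"
      using that by (intro SUP_least upper_cut_upper)
    finally show ?thesis .
  qed
  then show "Sup {U p | p. t \<le> of_rat p} \<le> upper_cut fn t"
    by (auto intro!: Sup_least)
qed

end

section \<open>A function with countably many values and a given cozero element\<close>

text \<open>The least possible \<open>n\<close> locates \<open>t\<close> in the gap 1/(n+1) < t
  \<le> 1/n, with no upper bound when \<open>n = 0\<close>. It serves for rational arguments (in the
  scale) and for real ones (in \<open>R_set\<close>).\<close>

lemma least_unit_fraction_below:
  fixes t :: "'a::archimedean_field"
  assumes "0 < t"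
  obtains n where "1 / of_nat (Suc n) < t" "\<And>m. n = Suc m \<Longrightarrow> t \<le> 1 / of_nat (Suc m)"
proof -
  let ?P = "\<lambda>n. 1 / of_nat (Suc n) < t"
  have "\<exists>n. ?P n"
    using reals_Archimedean[OF assms] by (auto simp: inverse_eq_divide)
  then have "?P (LEAST n. ?P n)" by (rule LeastI_ex)
  moreover have "t \<le> 1 / of_nat (Suc m)" if "(LEAST n. ?P n) = Suc m" for m
    using not_less_Least[of m ?P] that by (simp add: not_less)
  ultimately show ?thesis by (rule that)
qed

lemma Sup_range_in_Coz_c:
  fixes c :: "nat \<Rightarrow> 'a::frame"
  assumes c: "\<And>n. complemented (c n)"
  shows "Sup (range c) \<in> Coz_c"
proof -
  define e where "e n = Sup (c ` {..<n})" for n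
  have "complemented (e n)" for n
    unfolding e_def using c by (intro complemented_finite_Sup) auto
  then obtain b where b: "\<And>n. inf (e n) (b n) = bot" "\<And>n. sup (e n) (b n) = top"
    unfolding complemented_def by metis
  have e_mono: "e m \<le> e n" if "m \<le> n" for m n
    unfolding e_def using that by (intro Sup_subset_mono) auto
  have e_0: "e 0 = bot" by (simp add: e_def)
  have Sup_e: "(SUP n. e (Suc n)) = Sup (range c)"
  proof (rule antisym)
    show "(SUP n. e (Suc n)) \<le> Sup (range c)"
      unfolding e_def by (intro SUP_least Sup_subset_mono) auto
    have "c n \<le> e (Suc n)" for n
      unfolding e_def by (rule SUP_upper) simp
    then show "Sup (range c) \<le> (SUP n. e (Suc n))"
      by (intro SUP_mono) auto
  qed

  define x :: "nat \<Rightarrow> rat" where "x n = 1 / of_nat (Suc n)" for n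
  have x_pos: "0 < x n" for n by (simp add: x_def)
  have x_less: "x n < x m \<longleftrightarrow> m < n" for m n
    by (simp add: x_def divide_simps)
  \<comment> \<open>\<open>U p\<close> is the region where the function exceeds \<open>p\<close>,
    since on \<open>e (Suc n)\<close> it is at least \<open>x n\<close>; for \<open>p < 0\<close>
    this is everything. \<open>D q\<close> is the region where it is below \<open>q\<close>, since
    on the complement \<open>b n\<close> of \<open>e n\<close> it is at most
    \<open>x n\<close>.\<close>
  define U where "U p = (if p < 0 then top else Sup {e (Suc n) | n. p < x n})" for p
  define D where "D q = Sup {b n | n. x n < q}" for q
  have U_upper: "e (Suc n) \<le> U p" if "p < x n" for n p
    unfolding U_def using that by (auto intro: Sup_upper)
  have D_upper: "b n \<le> D q" if "x n < q" for n q
    unfolding D_def using that by (auto intro: Sup_upper)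
  have U_antimono: "U q \<le> U p" if "p \<le> q" for p q
    unfolding U_def using that by (auto intro!: Sup_subset_mono)
  have D_mono: "D p \<le> D q" if "p \<le> q" for p q
    unfolding D_def using that by (intro Sup_subset_mono) auto

  have scale: "scale U D"
  proof
    fix p q :: rat
    show "U p = Sup (U ` {p<..})"
    proof (rule antisym)
      show "U p \<le> Sup (U ` {p<..})"
      proof (cases "p < 0")
        case True
        \<comment> \<open>Every larger negative index has the same value \<open>top\<close>;
          \<open>p / 2\<close> is one.\<close>
        then have "U p = U (p / 2)" "p / 2 \<in> {p<..}" by (simp_all add: U_def)
        then show ?thesis by (metis SUP_upper)
      next
        case False
        have "e (Suc n) \<le> Sup (U ` {p<..})" if "p < x n" for n
        proof -
          obtain r where "p < r" "r < x n" using dense \<open>p < x n\<close> by blast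
          then show ?thesis by (intro SUP_upper2[of r] U_upper) auto
        qed
        with False show ?thesis by (auto simp: U_def[of p] intro!: Sup_least)
      qed
    qed (auto intro!: SUP_least U_antimono)
    show "D q = Sup (D ` {..<q})"
    proof (rule antisym)
      have "b n \<le> Sup (D ` {..<q})" if "x n < q" for n
      proof -
        obtain r where "x n < r" "r < q" using dense \<open>x n < q\<close> by blast
        then show ?thesis by (intro SUP_upper2[of r] D_upper) auto
      qed
      then show "D q \<le> Sup (D ` {..<q})" by (auto simp: D_def[of q] intro!: Sup_least)
    qed (auto intro!: SUP_least D_mono)
    show "inf (U p) (D q) = bot" if "q \<le> p"
    proof (cases "p < 0")
      case True
      then have "\<not> x n < q" for n
        using x_pos[of n] that by simp
      then show ?thesis by (simp add: D_def)
    next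
      case False
      have "inf (e (Suc m)) (b n) = bot" if "p < x m" "x n < q" for m n
      proof -
        \<comment> \<open>\<open>x\<close> is decreasing, so \<open>x n < q \<le> p < x m\<close>
          forces \<open>m < n\<close>, which is just enough for
          \<open>e (Suc m) \<le> e n\<close>.\<close>
        have "m < n" using that \<open>q \<le> p\<close> x_less[of n m] by simp
        then have "inf (e (Suc m)) (b n) \<le> inf (e n) (b n)"
          by (intro inf_mono e_mono) simp_all
        then show ?thesis by (simp add: b bot_unique)
      qed
      with False show ?thesis
        by (auto simp: U_def D_def Sup_inf_frame inf_Sup_frame
            intro!: antisym[OF _ bot_least] SUP_least)
    qed
    show "sup (U p) (D q) = top" if "p < q"
    proof (cases "p < 0")
      case True
      then show ?thesis by (simp add: U_def)
    next
      case False
      with that have "0 < q" by simp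
      \<comment> \<open>With the least \<open>n\<close>, the preceding fraction is at least
        \<open>q > p\<close>, so \<open>e n\<close> lies below \<open>U p\<close>; for
        \<open>n = 0\<close> there is no preceding one, but \<open>e 0 = bot\<close>. Thus the
        complements \<open>e n\<close> and \<open>b n\<close> provide the cover.\<close>
      then obtain n where n: "x n < q" "\<And>m. n = Suc m \<Longrightarrow> q \<le> x m"
        unfolding x_def using least_unit_fraction_below by blast
      have "e n \<le> U p"
        using n(2) that by (cases n) (auto simp: e_0 intro!: U_upper)
      moreover have "b n \<le> D q"
        using n(1) by (rule D_upper)
      ultimately have "sup (e n) (b n) \<le> sup (U p) (D q)"
        by (rule sup_mono)
      then show ?thesis by (simp add: b top_unique)
    qed
    have "U (- 1) = top" by (simp add: U_def)
    then show "Sup (range U) = top"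
      by (metis SUP_upper UNIV_I top_unique)
    \<comment> \<open>The values are at most \<open>x 0 = 1\<close>, so any bound above 1, here 2,
      gives \<open>top\<close>.\<close>
    have "b 0 = top" using b(2)[of 0] by (simp add: e_0)
    moreover have "b 0 \<le> D 2" by (intro D_upper) (simp add: x_def)
    ultimately have "D 2 = top" by (simp add: top_unique)
    then show "Sup (range D) = top"
      by (metis SUP_upper UNIV_I top_unique)
  qed
  then interpret scale U D .

  have "lower_cut fn 0 = bot"
  proof -
    have "D q = bot" if "q \<le> 0" for q
    proof -
      have "\<not> x n < q" for n
        using x_pos[of n] that by simp
      then show ?thesis by (simp add: D_def)
    qed
    then show ?thesis
      unfolding lower_cut_fn by (auto intro!: antisym[OF _ bot_least] Sup_least)
  qed
  moreover have "upper_cut fn 0 = Sup (range c)"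
  proof (rule antisym)
    have U_0: "U 0 = Sup (range c)"
      unfolding Sup_e[symmetric] by (simp add: U_def x_pos full_SetCompr_eq)
    show "upper_cut fn 0 \<le> Sup (range c)"
      unfolding upper_cut_fn U_0[symmetric] using U_antimono[of 0] by (auto intro!: Sup_least)
    show "Sup (range c) \<le> upper_cut fn 0"
      unfolding upper_cut_fn U_0[symmetric] by (intro Sup_upper) auto
  qed
  ultimately have coz: "coz fn = Sup (range c)"
    by (simp add: coz_eq_cuts[OF fn_in_RL])

  \<comment> \<open>A positive \<open>t\<close> other than these values lies in a gap between or
    above them, where a complementary pair \<open>b n\<close>, \<open>e n\<close> lies below the two
    cuts, which therefore join to \<open>top\<close>. For negative \<open>t\<close> the upper cut
    alone is \<open>top\<close>.\<close>
  have "R_set fn \<subseteq> insert 0 (range (\<lambda>n. of_rat (x n)))"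
  proof
    fix t assume "t \<in> R_set fn"
    then have ne: "sup (lower_cut fn t) (upper_cut fn t) \<noteq> top"
      by (simp add: R_set_iff[OF fn_in_RL])
    show "t \<in> insert 0 (range (\<lambda>n. of_rat (x n)))"
    proof (rule ccontr)
      assume t: "t \<notin> insert 0 (range (\<lambda>n. of_rat (x n)))"
      have le_lower: "D q \<le> lower_cut fn t" if "of_rat q \<le> t" for q
        unfolding lower_cut_fn using that by (intro Sup_upper) blast
      have le_upper: "U p \<le> upper_cut fn t" if "t \<le> of_rat p" for p
        unfolding upper_cut_fn using that by (intro Sup_upper) blast
      consider "t < 0" | "0 < t" using t by fastforce
      then show False
      proof cases
        case 1
        then obtain p where p: "t < of_rat p" "of_rat p < (0::real)"
          using of_rat_dense by blast
        then have "U p = top" by (simp add: U_def)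
        with le_upper[of p] p ne show False by (simp add: top_unique)
      next
        case 2
        have x_real: "of_rat (x n) = (1 / of_nat (Suc n) :: real)" for n
          by (simp add: x_def of_rat_divide of_rat_add)
        obtain n where n: "of_rat (x n) < t" "\<And>m. n = Suc m \<Longrightarrow> t \<le> of_rat (x m)"
          unfolding x_real using least_unit_fraction_below[OF 2] by blast
        obtain q where q: "of_rat (x n) < (of_rat q :: real)" "of_rat q < t"
          using of_rat_dense n(1) by blast
        have "b n \<le> D q" using q by (intro D_upper) (simp add: of_rat_less)
        also have "D q \<le> lower_cut fn t" using q by (intro le_lower) simp
        finally have "b n \<le> lower_cut fn t" .
        moreover have "e n \<le> upper_cut fn t"
        proof (cases n)
          case 0
          then show ?thesis by (simp add: e_0)
        next
          case (Suc m)
          \<comment> \<open>Minimality of \<open>n\<close> gives only \<open>t \<le> x m\<close>;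
            equality is excluded because \<open>t\<close> is not one of the values. Strictness
            leaves room for a rational \<open>p\<close>.\<close>
          then have "t < of_rat (x m)"
            using n(2)[of m] t by (auto simp: less_le)
          then obtain p where p: "t < of_rat p" "of_rat p < (of_rat (x m) :: real)"
            using of_rat_dense by blast
          have "e n \<le> U p" using p Suc by (auto intro!: U_upper simp: of_rat_less)
          also have "U p \<le> upper_cut fn t" using p by (intro le_upper) simp
          finally show ?thesis .
        qed
        ultimately have "sup (b n) (e n) \<le> sup (lower_cut fn t) (upper_cut fn t)"
          by (rule sup_mono)
        with ne show False by (simp add: b sup.commute[of "b n"] top_unique)
      qed
    qed
  qed
  then have "countable (R_set fn)"
    by (rule countable_subset) simp
  then have "fn \<in> C_c"
    by (simp add: C_c_def fn_in_RL)
  then show ?thesis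
    unfolding Coz_c_def using coz by (metis (mono_tags, lifting) mem_Collect_eq)
qed

lemma Coz_c_eq: "Coz_c = countable_complemented_joins"
proof (rule antisym[OF Coz_c_subset], rule subsetI)
  fix a :: 'a assume "a \<in> countable_complemented_joins"
  then obtain C where C: "a = Sup C" "countable C" "\<forall>c\<in>C. complemented c"
    unfolding countable_complemented_joins_def by blast
  \<comment> \<open>Adding \<open>bot\<close> leaves the join unchanged and makes the set nonempty,
    so that it can be enumerated by \<open>nat\<close>.\<close>
  define c where "c = from_nat_into (insert bot C)"
  have range: "range c = insert bot C"
    unfolding c_def using C(2) by (intro range_from_nat_into) auto
  then have "complemented (c n)" for n
    using C(3) complemented_bot by (metis insert_iff rangeI)
  then have "Sup (range c) \<in> Coz_c"
    by (rule Sup_range_in_Coz_c)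
  then show "a \<in> Coz_c"
    by (simp add: range C(1))
qed

section \<open>Subsets of a frame as \<open>\<sigma>\<close>-frames\<close>

text \<open>Joins in the structure are taken relative to \<open>M\<close>. When the join of the
  whole lattice lies in \<open>M\<close>, the upper bounds in \<open>M\<close> are the elements of
  \<open>M\<close> above it, so the two joins agree; the next lemma is the dual for meets.\<close>

lemma least_Upper_inherited_order:
  fixes M :: "'a::complete_lattice set"
  assumes "S \<subseteq> M" "Sup S \<in> M"
  shows "least (inherited_order M) s (Upper (inherited_order M) S) \<longleftrightarrow> s = Sup S"
proof -
  have "Upper (inherited_order M) S = {u \<in> M. Sup S \<le> u}"
    using assms(1) by (auto simp: Upper_def inherited_order_def Sup_le_iff)
  then show ?thesis
    using assms(2) by (auto simp: least_def inherited_order_def intro: antisym)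
qed

lemma greatest_Lower_inherited_order:
  fixes M :: "'a::complete_lattice set"
  assumes "S \<subseteq> M" "Inf S \<in> M"
  shows "greatest (inherited_order M) s (Lower (inherited_order M) S) \<longleftrightarrow> s = Inf S"
proof -
  have "Lower (inherited_order M) S = {l \<in> M. l \<le> Inf S}"
    using assms(1) by (auto simp: Lower_def inherited_order_def le_Inf_iff)
  then show ?thesis
    using assms(2) by (auto simp: greatest_def inherited_order_def intro: antisym)
qed

text \<open>The closure assumptions make the operations relative to \<open>M\<close> agree with
  those of the frame, so the distributive laws are inherited; binary joins are instances of
  countable ones.\<close>

lemma sigma_frame_inherited_order:
  fixes M :: "'a::frame set"
  assumes inf: "\<And>x y. x \<in> M \<Longrightarrow> y \<in> M \<Longrightarrow> inf x y \<in> M"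
    and Sup: "\<And>S. countable S \<Longrightarrow> S \<subseteq> M \<Longrightarrow> Sup S \<in> M"
  shows "sigma_frame (inherited_order M)"
proof -
  let ?L = "inherited_order M"
  have carrier: "carrier ?L = M" by (simp add: inherited_order_def)
  have join_Sup: "\<Squnion>\<^bsub>?L\<^esub>S = Sup S" if "countable S" "S \<subseteq> M" for S
    unfolding Lattice.sup_def least_Upper_inherited_order[OF that(2) Sup[OF that]] by simp
  have sup: "sup x y \<in> M" if "x \<in> M" "y \<in> M" for x y
    using Sup[of "{x, y}"] that by simp
  have join: "x \<squnion>\<^bsub>?L\<^esub> y = sup x y" if "x \<in> M" "y \<in> M" for x y
    unfolding join_def using join_Sup[of "{x, y}"] that by simp
  have Inf: "Inf {x, y} \<in> M" if "x \<in> M" "y \<in> M" for x y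
    using inf that by simp
  have meet: "x \<sqinter>\<^bsub>?L\<^esub> y = inf x y" if "x \<in> M" "y \<in> M" for x y
    unfolding meet_def Lattice.inf_def
    using that Inf by (simp add: greatest_Lower_inherited_order)
  show ?thesis
  proof (unfold_locales, unfold carrier)
    show "\<exists>s. least ?L s (Upper ?L {x, y})" if "x \<in> M" "y \<in> M" for x y
      using least_Upper_inherited_order[of "{x, y}" M] sup that by simp
    show "\<exists>s. greatest ?L s (Lower ?L {x, y})" if "x \<in> M" "y \<in> M" for x y
      using greatest_Lower_inherited_order[of "{x, y}" M] inf that by simp
    show "\<exists>s. least ?L s (Upper ?L S)" if "countable S" "S \<subseteq> M" for S
      using least_Upper_inherited_order[OF that(2) Sup[OF that]] by simp
    show "x \<sqinter>\<^bsub>?L\<^esub> (y \<squnion>\<^bsub>?L\<^esub> z) = (x \<sqinter>\<^bsub>?L\<^esub> y) \<squnion>\<^bsub>?L\<^esub> (x \<sqinter>\<^bsub>?L\<^esub> z)"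
      if "x \<in> M" "y \<in> M" "z \<in> M" for x y z
      using that by (simp add: join meet sup inf inf_sup_distrib1)
    show "a \<sqinter>\<^bsub>?L\<^esub> \<Squnion>\<^bsub>?L\<^esub>S = \<Squnion>\<^bsub>?L\<^esub>((\<lambda>s. a \<sqinter>\<^bsub>?L\<^esub> s) ` S)"
      if "a \<in> M" "countable S" "S \<subseteq> M" for a S
    proof -
      have eq: "(\<lambda>s. a \<sqinter>\<^bsub>?L\<^esub> s) ` S = (\<lambda>s. inf a s) ` S"
        using that meet by (intro image_cong) auto
      have "\<Squnion>\<^bsub>?L\<^esub>((\<lambda>s. inf a s) ` S) = Sup ((\<lambda>s. inf a s) ` S)"
        using that inf by (intro join_Sup) auto
      then show ?thesis
        using that Sup by (simp add: eq join_Sup meet inf_Sup_frame)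
    qed
  qed (auto simp: inherited_order_def)
qed

theorem theorem6p6:
  assumes "completely_regular TYPE('a::frame)"
  shows "sigma_frame (inherited_order (Coz_c :: 'a set))"
  unfolding Coz_c_eq
  by (intro sigma_frame_inherited_order inf_in_countable_complemented_joins
      Sup_in_countable_complemented_joins)

end
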